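(* Fix a positive rational $s$. There exists a constant $C(s)>0$ such that for every $n$, every connected graph $G=(V,E,(r_e)_{e\in E})$ on $n$ vertices with positive edge weights, and every integer $m\ge 2$, \[ \forall\,\varepsilon\in(0,1/4):\qquad t_{\mathrm{mix}}^{\mathrm{BB}(G,s,m)}(\varepsilon)\le C(s)\,\log\!\Big(\frac{n+m}{\varepsilon}\Big)\,\max_{i,j}\mathbb E\,\hat M_{i,j}(G). \] Moreover, writing $s=b/a$ with $a,b$ coprime positive integers, one may take $C(s)=C'\,a\,(p^* )^{-2}\log\big(12a(p^* )^{-2}\big)\log(a+b)$ for a universal constant $C'>0$, where $p^*=(5/12)^{2s}/(6B(s,s))$ if $s<20$ and $p^*=\frac16\big(1-\frac{20}{s+1}\big)$ if $s\ge 20$, with $B(\cdot,\cdot)$ the beta function.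
   Context: Let $G=(V,E,(r_e)_{e\in E})$ be a finite connected graph with vertex set $V=\{1,\dots,n\}$, edge set $E$ and edge weights $r_e>0$. For $s>0$ and an integer $m\ge0$ let $\Omega_{G,m}=\{\xi\in\mathbb N_0^V:\sum_{v\in V}\xi(v)=m\}$. The $m$-particle symmetric beta-binomial splitting process $\mathrm{BB}(G,s,m)$ is the continuous-time Markov chain on $\Omega_{G,m}$ with generator $\mathcal L f=\sum_{e\in E}\frac{r_e}{\sum_{e'\in E}r_{e'}}(\mathcal P_e f-f)$, where for $e=\{v,w\}$, $\mathcal P_ef(\xi)=\mathbb E[f(\xi')]$ with $\xi'(v)=X$, $\xi'(w)=\xi(v)+\xi(w)-X$, $\xi'(u)=\xi(u)$ for $u\notin e$, and $X\sim\mathrm{BetaBin}(\xi(v)+\xi(w),s,s)$, i.e. $\mathbb P(X=k)=\binom{N}{k}\frac{B(k+s,N-k+s)}{B(s,s)}$ for $N=\xi(v)+\xi(w)$, $0\le k\le N$. For an irreducible Markov process with equilibrium $\pi$ on a finite set, $t_{\mathrm{mix}}(\varepsilon)=\inf\{t\ge0:\max_{\xi_0}\|\mathcal L(\xi_t)-\pi\|_{\mathrm{TV}}\le\varepsilon\}$, where $\|\mu-\nu\|_{\mathrm{TV}}=\sum_\omega(\mu(\omega)-\nu(\omega))_+$; $t^{\mathrm{BB}(G,s,m)}_{\mathrm{mix}}$ denotes this for $\mathrm{BB}(G,s,m)$. For distinct $i,j\in V$, $\hat M_{i,j}(G)$ is the meeting time $\inf\{t\ge0:X_t=Y_t\}$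 of two independent continuous-time random walks $X,Y$ on $V$ with $X_0=i$, $Y_0=j$, each jumping from its current vertex $v$ to $w$ at rate $r_{\{v,w\}}/(2\sum_{e\in E}r_e)$ for every edge $\{v,w\}\in E$ (i.e. each moves as the single particle of $\mathrm{BB}(G,s,1)$). The maximum is over distinct $i,j\in V$. *)

theory Defs
  imports "HOL-Analysis.Analysis"
begin

section \<open>Finite continuous-time Markov chains (analytic description)\<close>

text \<open>Powers of a matrix indexed by a finite state set S.\<close>
fun mpow :: "'a set \<Rightarrow> ('a \<Rightarrow> 'a \<Rightarrow> real) \<Rightarrow> nat \<Rightarrow> 'a \<Rightarrow> 'a \<Rightarrow> real" where
  "mpow S Q 0 x y = (if x = y then 1 else 0)"
| "mpow S Q (Suc k) x y = (\<Sum>z\<in>S. Q x z * mpow S Q k z y)"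

text \<open>Matrix exponential exp(tQ); for a generator Q this is the transition
  semigroup, i.e. expm S Q t x y = P(X_t = y | X_0 = x).\<close>
definition expm :: "'a set \<Rightarrow> ('a \<Rightarrow> 'a \<Rightarrow> real) \<Rightarrow> real \<Rightarrow> 'a \<Rightarrow> 'a \<Rightarrow> real" where
  "expm S Q t x y = (\<Sum>k. t ^ k / fact k * mpow S Q k x y)"

definition tv_dist :: "'a set \<Rightarrow> ('a \<Rightarrow> real) \<Rightarrow> ('a \<Rightarrow> real) \<Rightarrow> real" where
  "tv_dist S \<mu> \<nu> = (\<Sum>x\<in>S. max 0 (\<mu> x - \<nu> x))"

definition is_stationary :: "'a set \<Rightarrow> ('a \<Rightarrow> 'a \<Rightarrow> real) \<Rightarrow> ('a \<Rightarrow> real) \<Rightarrow> bool" where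
  "is_stationary S Q \<pi> \<longleftrightarrow> (\<forall>x\<in>S. \<pi> x \<ge> 0) \<and> (\<forall>x. x \<notin> S \<longrightarrow> \<pi> x = 0)
     \<and> (\<Sum>x\<in>S. \<pi> x) = 1 \<and> (\<forall>y\<in>S. (\<Sum>x\<in>S. \<pi> x * Q x y) = 0)"

text \<open>The equilibrium (unique stationary distribution of an irreducible chain).\<close>
definition equilibrium :: "'a set \<Rightarrow> ('a \<Rightarrow> 'a \<Rightarrow> real) \<Rightarrow> 'a \<Rightarrow> real" where
  "equilibrium S Q = (THE \<pi>. is_stationary S Q \<pi>)"

definition tmix :: "'a set \<Rightarrow> ('a \<Rightarrow> 'a \<Rightarrow> real) \<Rightarrow> real \<Rightarrow> real" where
  "tmix S Q \<epsilon> = Inf {t. t \<ge> 0 \<and>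
      (\<forall>x0\<in>S. tv_dist S (expm S Q t x0) (equilibrium S Q) \<le> \<epsilon>)}"

section \<open>Weighted graphs on V = {1..n}\<close>

definition weighted_conn_graph :: "nat \<Rightarrow> nat set set \<Rightarrow> (nat set \<Rightarrow> real) \<Rightarrow> bool" where
  "weighted_conn_graph n E r \<longleftrightarrow>
     (\<forall>e\<in>E. e \<subseteq> {1..n} \<and> card e = 2) \<and> (\<forall>e\<in>E. r e > 0) \<and>
     (\<forall>u\<in>{1..n}. \<forall>v\<in>{1..n}. (u, v) \<in> {(x, y). {x, y} \<in> E}\<^sup>*)"

definition total_weight :: "nat set set \<Rightarrow> (nat set \<Rightarrow> real) \<Rightarrow> real" where
  "total_weight E r = (\<Sum>e\<in>E. r e)"

section \<open>Beta-binomial splitting process BB(G,s,m)\<close>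

definition betabin :: "nat \<Rightarrow> real \<Rightarrow> nat \<Rightarrow> real" where
  "betabin N s k = (if k \<le> N then real (N choose k) * Beta (real k + s) (real (N - k) + s) / Beta s s
                    else 0)"

definition config_space :: "nat \<Rightarrow> nat \<Rightarrow> (nat \<Rightarrow> nat) set" where
  "config_space n m = {\<xi>. (\<forall>u. u \<notin> {1..n} \<longrightarrow> \<xi> u = 0) \<and> (\<Sum>v\<in>{1..n}. \<xi> v) = m}"

text \<open>Transition kernel P_e for e = {v,w}, with v = Min e, w = Max e.\<close>
definition split_kernel :: "real \<Rightarrow> nat set \<Rightarrow> (nat \<Rightarrow> nat) \<Rightarrow> (nat \<Rightarrow> nat) \<Rightarrow> real" where
  "split_kernel s e \<xi> \<eta> =
    (let v = Min e; w = Max e; N = \<xi> v + \<xi> w in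
     if (\<forall>u. u \<notin> e \<longrightarrow> \<eta> u = \<xi> u) \<and> \<eta> v + \<eta> w = N then betabin N s (\<eta> v) else 0)"

text \<open>Generator matrix: L f = sum_e r_e/R (P_e f - f).\<close>
definition BB_gen :: "nat set set \<Rightarrow> (nat set \<Rightarrow> real) \<Rightarrow> real \<Rightarrow> (nat \<Rightarrow> nat) \<Rightarrow> (nat \<Rightarrow> nat) \<Rightarrow> real" where
  "BB_gen E r s \<xi> \<eta> = (\<Sum>e\<in>E. r e / total_weight E r *
       (split_kernel s e \<xi> \<eta> - (if \<xi> = \<eta> then 1 else 0)))"

definition tmix_BB :: "nat \<Rightarrow> nat set set \<Rightarrow> (nat set \<Rightarrow> real) \<Rightarrow> real \<Rightarrow> nat \<Rightarrow> real \<Rightarrow> real" where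
  "tmix_BB n E r s m \<epsilon> = tmix (config_space n m) (BB_gen E r s) \<epsilon>"

section \<open>Meeting time of two independent random walks\<close>

text \<open>Generator of a single walker: jumps v -> w at rate r_{v,w}/(2R).\<close>
definition walk_gen :: "nat \<Rightarrow> nat set set \<Rightarrow> (nat set \<Rightarrow> real) \<Rightarrow> nat \<Rightarrow> nat \<Rightarrow> real" where
  "walk_gen n E r x y =
     (if x \<noteq> y then (if {x, y} \<in> E then r {x, y} / (2 * total_weight E r) else 0)
      else - (\<Sum>z\<in>{1..n} - {x}. if {x, z} \<in> E then r {x, z} / (2 * total_weight E r) else 0))"

text \<open>Generator of the pair (X,Y) of independent walkers.\<close>
definition pair_gen :: "nat \<Rightarrow> nat set set \<Rightarrow> (nat set \<Rightarrow> real) \<Rightarrow> nat \<times> nat \<Rightarrow> nat \<times> nat \<Rightarrow> real" where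
  "pair_gen n E r p q =
     walk_gen n E r (fst p) (fst q) * (if snd p = snd q then 1 else 0)
   + (if fst p = fst q then 1 else 0) * walk_gen n E r (snd p) (snd q)"

definition off_diag :: "nat \<Rightarrow> (nat \<times> nat) set" where
  "off_diag n = {(x, y). x \<in> {1..n} \<and> y \<in> {1..n} \<and> x \<noteq> y}"

text \<open>P(M_{i,j} > t): the pair process killed on the diagonal, i.e. the
  semigroup of the generator restricted to off-diagonal states.\<close>
definition meet_tail :: "nat \<Rightarrow> nat set set \<Rightarrow> (nat set \<Rightarrow> real) \<Rightarrow> nat \<Rightarrow> nat \<Rightarrow> real \<Rightarrow> real" where
  "meet_tail n E r i j t = (\<Sum>q\<in>off_diag n. expm (off_diag n) (pair_gen n E r) t (i, j) q)"

text \<open>E[M_{i,j}] = integral over [0,\<infinity>) of P(M_{i,j} > t).\<close>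
definition exp_meet :: "nat \<Rightarrow> nat set set \<Rightarrow> (nat set \<Rightarrow> real) \<Rightarrow> nat \<Rightarrow> nat \<Rightarrow> ennreal" where
  "exp_meet n E r i j = (\<integral>\<^sup>+ t. ennreal (meet_tail n E r i j t) * indicator {0..} t \<partial>lborel)"

definition max_exp_meet :: "nat \<Rightarrow> nat set set \<Rightarrow> (nat set \<Rightarrow> real) \<Rightarrow> ennreal" where
  "max_exp_meet n E r = (SUP p\<in>off_diag n. exp_meet n E r (fst p) (snd p))"

section \<open>The bound\<close>

definition BB_mixing_bound :: "real \<Rightarrow> real \<Rightarrow> bool" where
  "BB_mixing_bound s C \<longleftrightarrow>
     (\<forall>n E r m \<epsilon>. weighted_conn_graph n E r \<longrightarrow> m \<ge> 2 \<longrightarrow> 0 < \<epsilon> \<longrightarrow> \<epsilon> < 1/4 \<longrightarrow>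
        ennreal (tmix_BB n E r s m \<epsilon>)
          \<le> ennreal (C * ln ((real n + real m) / \<epsilon>)) * max_exp_meet n E r)"

definition p_star :: "real \<Rightarrow> real" where
  "p_star s = (if s < 20 then (5/12) powr (2 * s) / (6 * Beta s s) else (1 - 20 / (s + 1)) / 6)"

definition C_of :: "real \<Rightarrow> nat \<Rightarrow> nat \<Rightarrow> real \<Rightarrow> real" where
  "C_of C' a b s = C' * real a * (p_star s) powr (-2) * ln (12 * real a * (p_star s) powr (-2))
                   * ln (real a + real b)"

end

theory Submission
  imports Defs
begin

text \<open>
  Given the rung edges and a Beta(s,s) variable for each ring, the particles of BB(G,s,m) move
  independently: a particle on the ringing edge goes to its first endpoint with the drawn
  probability. Run two systems with the same rings and the same Beta variables, pairing the
  particles; when both particles of a pair sit on the ringing edge, send them to the same endpoint.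
  Before that, each of them jumps across an edge \<open>e\<close> at rate \<open>r e / (2 R)\<close>, and two particles at the
  two ends of \<open>e\<close> coalesce at rate \<open>r e / R\<close>, which is also the rate at which independent walkers
  meet across \<open>e\<close>. Hence a pair coalesces exactly at the meeting time of two independent walkers, and
  the distance to equilibrium at time \<open>t\<close> is at most \<open>m\<close> times the largest tail of a meeting time.
  These tails decay geometrically on the scale of the largest expected meeting time, so the
  constant can be taken to be \<open>2 exp 1\<close> for all \<open>s\<close>; this is at most a universal multiple of the
  stated constant because \<open>p_star s \<le> 1\<close>.

  Pairs are treated one at a time, after replacing both chains by Poisson many steps of a
  discrete kernel, so that the coupling becomes an inequality between powers of two kernels.
\<close>

section \<open>Uniformization\<close>

text \<open>Row sums at most 1, rather than equal to 1, let one locale serve both the splitting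
  chain, which conserves mass, and the pair of walkers, which loses mass when they meet.\<close>

locale uniformized =
  fixes S :: "'a set" and K Q :: "'a \<Rightarrow> 'a \<Rightarrow> real"
  assumes finite_states: "finite S"
    and K_nonneg: "\<And>x y. x \<in> S \<Longrightarrow> y \<in> S \<Longrightarrow> 0 \<le> K x y"
    and K_row: "\<And>x. x \<in> S \<Longrightarrow> (\<Sum>y\<in>S. K x y) \<le> 1"
    and Q_eq: "\<And>x y. x \<in> S \<Longrightarrow> y \<in> S \<Longrightarrow> Q x y = K x y - (if x = y then 1 else 0)"
begin

section \<open>Powers of a substochastic kernel\<close>

lemma mpow_nonneg: "x \<in> S \<Longrightarrow> y \<in> S \<Longrightarrow> 0 \<le> mpow S K k x y"
  by (induction k arbitrary: x) (auto intro!: sum_nonneg mult_nonneg_nonneg K_nonneg)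

lemma mpow_row: "x \<in> S \<Longrightarrow> (\<Sum>y\<in>S. mpow S K k x y) \<le> 1"
proof (induction k arbitrary: x)
  case 0
  then show ?case by (simp add: finite_states)
next
  case (Suc k)
  have "(\<Sum>y\<in>S. mpow S K (Suc k) x y) = (\<Sum>z\<in>S. K x z * (\<Sum>y\<in>S. mpow S K k z y))"
    unfolding mpow.simps sum_distrib_left by (rule sum.swap)
  also have "\<dots> \<le> (\<Sum>z\<in>S. K x z * 1)"
    using Suc by (intro sum_mono mult_left_mono) (auto simp: K_nonneg)
  also have "\<dots> \<le> 1" using K_row[OF Suc.prems] by simp
  finally show ?case .
qed

lemma mpow_le_1:
  assumes "x \<in> S" "y \<in> S" shows "mpow S K k x y \<le> 1"
proof -
  have "mpow S K k x y \<le> (\<Sum>y\<in>S. mpow S K k x y)"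
    by (rule member_le_sum) (use assms mpow_nonneg finite_states in auto)
  then show ?thesis using mpow_row[OF assms(1), of k] by linarith
qed

lemma mpow_add:
  "x \<in> S \<Longrightarrow> mpow S K (i + j) x y = (\<Sum>z\<in>S. mpow S K i x z * mpow S K j z y)"
proof (induction i arbitrary: x)
  case 0
  then show ?case by (simp add: finite_states if_distrib[of "\<lambda>a. a * _"] cong: if_cong)
next
  case (Suc i)
  have "mpow S K (Suc i + j) x y = (\<Sum>u\<in>S. \<Sum>z\<in>S. K x u * mpow S K i u z * mpow S K j z y)"
    by (simp add: Suc sum_distrib_left mult.assoc)
  also have "\<dots> = (\<Sum>z\<in>S. mpow S K (Suc i) x z * mpow S K j z y)"
    by (subst sum.swap) (simp add: sum_distrib_right)
  finally show ?case .
qed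

text \<open>The binomial theorem for \<open>(K - 1) ^ k\<close>, valid because the identity commutes
  with \<open>K\<close>; the induction step is Pascal's rule for the signed coefficients.\<close>

lemma mpow_generator:
  "x \<in> S \<Longrightarrow> y \<in> S \<Longrightarrow>
    mpow S Q k x y = (\<Sum>j\<le>k. real (k choose j) * (-1) ^ (k - j) * mpow S K j x y)"
proof (induction k arbitrary: x)
  case (Suc k)
  let ?c = "\<lambda>k j. real (k choose j) * (-1) ^ (k - j)"
  let ?M = "\<lambda>j. mpow S K j x y"
  have "mpow S Q (Suc k) x y
      = (\<Sum>z\<in>S. K x z * mpow S Q k z y) - (\<Sum>z\<in>S. (if x = z then 1 else 0) * mpow S Q k z y)"
    unfolding sum_subtractf[symmetric] mpow.simps
    by (intro sum.cong refl) (use Suc.prems in \<open>simp add: Q_eq algebra_simps\<close>)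
  also have "(\<Sum>z\<in>S. (if x = z then 1 else 0) * mpow S Q k z y) = mpow S Q k x y"
    using Suc.prems by (simp add: finite_states if_distrib[of "\<lambda>a. a * _"] cong: if_cong)
  also have "(\<Sum>z\<in>S. K x z * mpow S Q k z y) = (\<Sum>z\<in>S. \<Sum>j\<le>k. K x z * (?c k j * mpow S K j z y))"
    by (simp add: Suc sum_distrib_left)
  also have "\<dots> = (\<Sum>j\<le>k. ?c k j * ?M (Suc j))"
    by (subst sum.swap) (simp add: sum_distrib_left algebra_simps)
  also have "mpow S Q k x y = (\<Sum>j\<le>k. ?c k j * ?M j)"
    using Suc by simp
  also have "(\<Sum>j\<le>k. ?c k j * ?M (Suc j)) - (\<Sum>j\<le>k. ?c k j * ?M j)
      = (\<Sum>j\<le>Suc k. ?c (Suc k) j * ?M j)"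
  proof -
    \<comment> \<open>Since \<open>k choose Suc k\<close> is 0, one more term may be added, so that
      splitting off index 0 aligns this sum with the shifted one.\<close>
    have "(\<Sum>j\<le>k. ?c k j * ?M j) = (\<Sum>j\<le>Suc k. ?c k j * ?M j)"
      by simp
    also have "\<dots> = (-1) ^ k * ?M 0 + (\<Sum>j\<le>k. ?c k (Suc j) * ?M (Suc j))"
      by (subst sum.atMost_Suc_shift) simp
    finally have "(\<Sum>j\<le>k. ?c k j * ?M (Suc j)) - (\<Sum>j\<le>k. ?c k j * ?M j)
       = - ((-1) ^ k * ?M 0) + (\<Sum>j\<le>k. (?c k j - ?c k (Suc j)) * ?M (Suc j))"
      by (simp only: sum_subtractf left_diff_distrib)
    also have "(\<Sum>j\<le>k. (?c k j - ?c k (Suc j)) * ?M (Suc j)) = (\<Sum>j\<le>k. ?c (Suc k) (Suc j) * ?M (Suc j))"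
    proof (intro sum.cong refl)
      fix j assume "j \<in> {..k}"
      \<comment> \<open>Truncated subtraction makes both \<open>k - k\<close> and
        \<open>k - Suc k\<close> equal to 0, so the top index is a case of its own.\<close>
      then consider "j = k" | i where "k - j = Suc i" "k - Suc j = i"
        by (metis Suc_diff_Suc atMost_iff le_neq_implies_less)
      then have "?c k j - ?c k (Suc j) = ?c (Suc k) (Suc j)"
        by cases (simp_all add: algebra_simps)
      then show "(?c k j - ?c k (Suc j)) * ?M (Suc j) = ?c (Suc k) (Suc j) * ?M (Suc j)"
        by (simp only:)
    qed
    also have "- ((-1) ^ k * ?M 0) + \<dots> = (\<Sum>j\<le>Suc k. ?c (Suc k) j * ?M j)"
      by (subst sum.atMost_Suc_shift) simp
    finally show ?thesis .
  qed
  finally show ?case .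
qed simp

lemma summable_weighted_mpow:
  assumes "x \<in> S" "y \<in> S"
  shows "summable (\<lambda>k. norm (t ^ k / fact k * mpow S K k x y))"
proof (rule summable_comparison_test')
  show "summable (\<lambda>k. norm (t ^ k /\<^sub>R fact k))" by (rule summable_norm_exp)
  fix k :: nat
  show "norm (norm (t ^ k / fact k * mpow S K k x y)) \<le> norm (t ^ k /\<^sub>R fact k)"
    using mpow_nonneg[OF assms, of k] mpow_le_1[OF assms, of k]
      mult_left_le[of "mpow S K k x y" "\<bar>t ^ k\<bar> * inverse (fact k)"]
    by (simp add: abs_mult divide_inverse mult.commute)
qed

text \<open>A chain with generator \<open>K - 1\<close> makes Poisson many steps of \<open>K\<close>.\<close>

lemma expm_sums:
  assumes "x \<in> S" "y \<in> S"
  shows "(\<lambda>k. exp (-t) * (t ^ k / fact k) * mpow S K k x y) sums expm S Q t x y"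
proof -
  let ?a = "\<lambda>k. t ^ k / fact k * mpow S K k x y" and ?b = "\<lambda>k. (-t) ^ k /\<^sub>R fact k"
  have a: "summable (\<lambda>k. norm (?a k))" by (rule summable_weighted_mpow[OF assms])
  have b: "summable (\<lambda>k. norm (?b k))" by (rule summable_norm_exp)
  \<comment> \<open>The series for \<open>exp (t K)\<close> is multiplied by the scalar series for
    \<open>exp (-t)\<close>; by \<open>mpow_generator\<close> the product has the coefficients of
    \<open>exp (t (K - 1))\<close>.\<close>
  have "(\<Sum>i\<le>k. ?a i * ?b (k - i)) = t ^ k / fact k * mpow S Q k x y" for k
    unfolding mpow_generator[OF assms] sum_distrib_left
  proof (intro sum.cong refl)
    fix i assume "i \<in> {..k}"
    then have i: "i \<le> k" by simp
    have t: "t ^ k = t ^ i * t ^ (k - i)" using i by (simp flip: power_add)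
    have m: "(-t) ^ (k - i) = (-1) ^ (k - i) * t ^ (k - i)" by (rule power_minus)
    show "?a i * ?b (k - i) = t ^ k / fact k * (real (k choose i) * (-1) ^ (k - i) * mpow S K i x y)"
      unfolding t m binomial_fact[OF i] by (simp add: divide_simps)
  qed
  with Cauchy_product[OF a b] have "expm S Q t x y = (\<Sum>k. ?a k) * (\<Sum>k. ?b k)"
    by (simp add: expm_def)
  also have "(\<Sum>k. ?b k) = exp (-t)" by (simp add: exp_def)
  finally have "expm S Q t x y = exp (-t) * (\<Sum>k. ?a k)" by simp
  moreover have "(\<lambda>k. exp (-t) * ?a k) sums (exp (-t) * (\<Sum>k. ?a k))"
    using summable_norm_cancel[OF a] by (intro sums_mult summable_sums)
  ultimately show ?thesis by (simp add: mult.assoc)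
qed

text \<open>Through this form, termwise inequalities between powers of two kernels become
  inequalities between the two semigroups at the same time.\<close>

lemma expm_sum_sums:
  assumes "x \<in> S"
  shows "(\<lambda>k. exp (-t) * (t ^ k / fact k) * (\<Sum>y\<in>S. mpow S K k x y * f y))
           sums (\<Sum>y\<in>S. expm S Q t x y * f y)"
proof -
  have "(\<lambda>k. \<Sum>y\<in>S. exp (-t) * (t ^ k / fact k) * mpow S K k x y * f y)
      sums (\<Sum>y\<in>S. expm S Q t x y * f y)"
    by (intro sums_sum sums_mult2 expm_sums assms)
  then show ?thesis by (simp add: sum_distrib_left mult.assoc)
qed

section \<open>Row sums and the semigroup law\<close>

lemma expm_nonneg:
  assumes "x \<in> S" "y \<in> S" "0 \<le> t" shows "0 \<le> expm S Q t x y"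
  by (rule sums_le[OF _ sums_zero expm_sums[OF assms(1,2)]])
     (use assms mpow_nonneg in auto)

lemma poisson_sums: "(\<lambda>k. exp (-t) * (t ^ k / fact k)) sums (1::real)"
proof -
  have "(\<lambda>k. exp (-t) * (t ^ k /\<^sub>R fact k)) sums (exp (-t) * exp t)"
    by (intro sums_mult exp_converges)
  then show ?thesis by (simp add: divide_inverse mult.commute flip: exp_add)
qed

lemma expm_row:
  assumes "x \<in> S" "0 \<le> t" shows "(\<Sum>y\<in>S. expm S Q t x y) \<le> 1"
proof -
  have "(\<lambda>k. exp (-t) * (t ^ k / fact k) * (\<Sum>y\<in>S. mpow S K k x y)) sums (\<Sum>y\<in>S. expm S Q t x y)"
    using expm_sum_sums[OF assms(1), of t "\<lambda>_. 1"] by simp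
  from sums_le[OF _ this poisson_sums[of t]] show ?thesis
    using mpow_row[OF assms(1)] assms(2) by (meson divide_nonneg_nonneg exp_ge_zero fact_ge_zero
        mult_left_le mult_nonneg_nonneg zero_le_power)
qed

text \<open>The term \<open>k = 0\<close>, no step taken, already contributes
  \<open>exp (-t)\<close>. For the walkers this makes every meeting-time tail positive.\<close>

lemma expm_row_ge:
  assumes "x \<in> S" "0 \<le> t" shows "exp (-t) \<le> (\<Sum>y\<in>S. expm S Q t x y)"
proof -
  have s: "(\<lambda>k. exp (-t) * (t ^ k / fact k) * (\<Sum>y\<in>S. mpow S K k x y)) sums (\<Sum>y\<in>S. expm S Q t x y)"
    using expm_sum_sums[OF assms(1), of t "\<lambda>_. 1"] by simp
  have "(\<Sum>k<Suc 0. exp (-t) * (t ^ k / fact k) * (\<Sum>y\<in>S. mpow S K k x y)) \<le> (\<Sum>y\<in>S. expm S Q t x y)"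
    unfolding sums_unique[OF s]
    by (intro sum_le_suminf sums_summable[OF s] mult_nonneg_nonneg sum_nonneg)
       (use assms mpow_nonneg in auto)
  then show ?thesis using assms by (simp add: finite_states)
qed

text \<open>The series at \<open>t\<close> and \<open>u\<close> are multiplied;
  \<open>mpow_add\<close> collects the kernel powers and the binomial theorem the scalars.\<close>

lemma expm_add:
  assumes "x \<in> S" "y \<in> S"
  shows "expm S Q (t + u) x y = (\<Sum>z\<in>S. expm S Q t x z * expm S Q u z y)"
proof -
  let ?a = "\<lambda>z k. t ^ k / fact k * mpow S K k x z" and ?b = "\<lambda>z k. u ^ k / fact k * mpow S K k z y"
  have e: "expm S Q t x y = exp (-t) * (\<Sum>k. t ^ k / fact k * mpow S K k x y)" if "x \<in> S" "y \<in> S" for t x y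
    using sums_unique[OF expm_sums[OF that, of t]]
      suminf_mult[OF summable_norm_cancel[OF summable_weighted_mpow[OF that]], of "exp (-t)" t]
    by (simp only: mult.assoc)
  have "(\<lambda>k. \<Sum>z\<in>S. \<Sum>i\<le>k. ?a z i * ?b z (k - i)) sums (\<Sum>z\<in>S. (\<Sum>k. ?a z k) * (\<Sum>k. ?b z k))"
    by (intro sums_sum Cauchy_product_sums summable_weighted_mpow assms)
  moreover have "(\<Sum>z\<in>S. \<Sum>i\<le>k. ?a z i * ?b z (k - i)) = (t + u) ^ k / fact k * mpow S K k x y" for k
  proof -
    have "(\<Sum>z\<in>S. \<Sum>i\<le>k. ?a z i * ?b z (k - i))
        = (\<Sum>i\<le>k. t ^ i / fact i * (u ^ (k - i) / fact (k - i)) * (\<Sum>z\<in>S. mpow S K i x z * mpow S K (k - i) z y))"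
      by (subst sum.swap) (simp add: sum_distrib_left algebra_simps)
    also have "\<dots> = (\<Sum>i\<le>k. t ^ i / fact i * (u ^ (k - i) / fact (k - i)) * mpow S K k x y)"
      by (intro sum.cong refl) (simp flip: mpow_add[OF assms(1)])
    also have "\<dots> = (\<Sum>i\<le>k. real (k choose i) * t ^ i * u ^ (k - i)) / fact k * mpow S K k x y"
      unfolding sum_divide_distrib sum_distrib_right
      by (intro sum.cong refl) (simp add: binomial_fact)
    finally show ?thesis by (simp add: binomial_ring)
  qed
  ultimately have "(\<Sum>k. (t + u) ^ k / fact k * mpow S K k x y) = (\<Sum>z\<in>S. (\<Sum>k. ?a z k) * (\<Sum>k. ?b z k))"
    by (simp add: sums_iff)
  moreover have "exp (- t - u) = exp (- t) * exp (- u)" by (simp flip: exp_add)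
  ultimately show ?thesis
    using assms by (simp add: e sum_distrib_left algebra_simps)
qed

text \<open>Being annihilated by \<open>Q\<close> means being fixed by \<open>K\<close>, hence by
  all its powers, and the Poisson weights sum to 1.\<close>

lemma stationary_expm:
  assumes "\<And>y. y \<in> S \<Longrightarrow> (\<Sum>x\<in>S. \<pi> x * Q x y) = 0" and "y \<in> S"
  shows "(\<Sum>x\<in>S. \<pi> x * expm S Q t x y) = \<pi> y"
proof -
  have K: "(\<Sum>x\<in>S. \<pi> x * K x y) = \<pi> y" if "y \<in> S" for y
  proof -
    have "(\<Sum>x\<in>S. \<pi> x * Q x y) = (\<Sum>x\<in>S. \<pi> x * K x y) - (\<Sum>x\<in>S. \<pi> x * (if x = y then 1 else 0))"
      unfolding sum_subtractf[symmetric] by (intro sum.cong refl) (simp add: Q_eq that algebra_simps)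
    then show ?thesis using assms(1)[OF that] that
      by (simp add: finite_states if_distrib[of "\<lambda>a. _ * a"] cong: if_cong)
  qed
  have M: "(\<Sum>x\<in>S. \<pi> x * mpow S K k x y) = \<pi> y" for k
  proof (induction k)
    case 0
    then show ?case using assms(2)
      by (simp add: finite_states if_distrib[of "\<lambda>a. _ * a"] cong: if_cong)
  next
    case (Suc k)
    have "(\<Sum>x\<in>S. \<pi> x * mpow S K (Suc k) x y) = (\<Sum>z\<in>S. (\<Sum>x\<in>S. \<pi> x * K x z) * mpow S K k z y)"
      by (simp add: sum_distrib_left sum_distrib_right mult.assoc) (rule sum.swap)
    then show ?case using Suc K by simp
  qed
  have "(\<lambda>k. \<Sum>x\<in>S. \<pi> x * (exp (-t) * (t ^ k / fact k) * mpow S K k x y))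
      sums (\<Sum>x\<in>S. \<pi> x * expm S Q t x y)"
    by (intro sums_sum sums_mult expm_sums assms(2))
  moreover have "(\<Sum>x\<in>S. \<pi> x * (exp (-t) * (t ^ k / fact k) * mpow S K k x y))
     = exp (-t) * (t ^ k / fact k) * \<pi> y" for k
    by (simp add: sum_distrib_left algebra_simps flip: M[of k])
  ultimately have "(\<lambda>k. exp (-t) * (t ^ k / fact k) * \<pi> y) sums (\<Sum>x\<in>S. \<pi> x * expm S Q t x y)"
    by (simp only:)
  with sums_mult2[OF poisson_sums[of t], of "\<pi> y"] show ?thesis
    using sums_unique2 by fastforce
qed

end

section \<open>Beta-binomial weights\<close>

text \<open>Up to the factor \<open>Gamma s\<close> this is the rising factorial of \<open>s\<close>
  over \<open>fact k\<close>. A beta-binomial probability is a product of such weights at the two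
  endpoints, times a factor of \<open>N\<close> alone; both the urn recursion and the reversible
  measure rest on this factorization.\<close>

definition bb_weight :: "real \<Rightarrow> nat \<Rightarrow> real" where
  "bb_weight s k = Gamma (real k + s) / fact k"

definition bb_norm :: "real \<Rightarrow> nat \<Rightarrow> real" where
  "bb_norm s N = fact N / (Gamma (real N + 2 * s) * Beta s s)"

lemma Beta_pos: "0 < s \<Longrightarrow> 0 < Beta s (s::real)"
  by (simp add: Beta_def Gamma_real_pos)

lemma bb_weight_pos: "0 < s \<Longrightarrow> 0 < bb_weight s k"
  by (simp add: bb_weight_def Gamma_real_pos)

lemma bb_norm_pos: "0 < s \<Longrightarrow> 0 < bb_norm s k"
  by (simp add: bb_norm_def Gamma_real_pos Beta_pos)

lemma betabin_eq:
  assumes "0 < s" "k \<le> N"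
  shows "betabin N s k = bb_norm s N * bb_weight s k * bb_weight s (N - k)"
proof -
  have "real k + s + (real (N - k) + s) = real N + 2 * s" using assms by (simp add: of_nat_diff)
  then have "Beta (real k + s) (real (N - k) + s)
      = Gamma (real k + s) * Gamma (real (N - k) + s) / Gamma (real N + 2 * s)"
    by (simp only: Beta_def)
  then show ?thesis
    using assms by (simp add: betabin_def bb_norm_def bb_weight_def binomial_fact mult_ac del: of_nat_diff)
qed

lemma bb_weight_Suc:
  assumes "0 < s"
  shows "real (Suc k) * bb_weight s (Suc k) = (real k + s) * bb_weight s k"
proof -
  have "Gamma ((real k + s) + 1) = (real k + s) * Gamma (real k + s)"
    by (rule Gamma_plus1) (use assms in \<open>auto simp: nonpos_Ints_def\<close>)
  then show ?thesis by (simp add: bb_weight_def add_ac divide_simps)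
qed

lemma bb_norm_Suc:
  assumes "0 < s"
  shows "bb_norm s (Suc N) = bb_norm s N * real (Suc N) / (real N + 2 * s)"
proof -
  have "Gamma ((real N + 2 * s) + 1) = (real N + 2 * s) * Gamma (real N + 2 * s)"
    by (rule Gamma_plus1) (use assms in \<open>auto simp: nonpos_Ints_def\<close>)
  then show ?thesis by (simp add: bb_norm_def add_ac mult_ac)
qed

lemma betabin_nonneg: "0 < s \<Longrightarrow> 0 \<le> betabin N s k"
  by (cases "k \<le> N") (auto simp: betabin_eq bb_norm_pos bb_weight_pos less_imp_le, simp add: betabin_def)

lemma betabin_sym: "0 < s \<Longrightarrow> k \<le> N \<Longrightarrow> betabin N s (N - k) = betabin N s k"
  by (simp add: betabin_eq)

text \<open>Polya urn: the \<open>N + 1\<close>-st particle joins a vertex holding \<open>k\<close> of the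
  first \<open>N\<close> particles with probability \<open>(k + s) / (N + 2 s)\<close>.\<close>

lemma betabin_polya:
  assumes "0 < s"
  shows "(\<Sum>k\<le>Suc N. betabin (Suc N) s k * \<phi> k)
    = (\<Sum>k\<le>N. betabin N s k * ((real k + s) / (real N + 2 * s) * \<phi> (Suc k)
                                + (real (N - k) + s) / (real N + 2 * s) * \<phi> k))"
proof -
  let ?w = "bb_weight s" and ?D = "real N + 2 * s"
  let ?c = "bb_norm s N / ?D"
  \<comment> \<open>The factor \<open>Suc N\<close> from \<open>bb_norm_Suc\<close> is split as
    \<open>k + (Suc N - k)\<close>; each half will be absorbed by one of the two weights through
    \<open>bb_weight_Suc\<close>.\<close>
  have 1: "betabin (Suc N) s k * \<phi> k
     = ?c * (real k * ?w k * ?w (Suc N - k) * \<phi> k) + ?c * (real (Suc N - k) * ?w (Suc N - k) * ?w k * \<phi> k)"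
    if "k \<le> Suc N" for k
  proof -
    have "betabin (Suc N) s k * \<phi> k = ?c * (real k + real (Suc N - k)) * ?w k * ?w (Suc N - k) * \<phi> k"
      using that assms by (simp add: betabin_eq bb_norm_Suc of_nat_diff)
    then show ?thesis by (simp only: algebra_simps)
  qed
  have "(\<Sum>k\<le>Suc N. betabin (Suc N) s k * \<phi> k)
     = (\<Sum>k\<le>Suc N. ?c * (real k * ?w k * ?w (Suc N - k) * \<phi> k))
      + (\<Sum>k\<le>Suc N. ?c * (real (Suc N - k) * ?w (Suc N - k) * ?w k * \<phi> k))"
    unfolding sum.distrib[symmetric] by (intro sum.cong refl) (simp only: 1 atMost_iff)
  \<comment> \<open>Here the term \<open>k = 0\<close> vanishes; in the other half it is the term
    \<open>k = Suc N\<close>.\<close>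
  also have "(\<Sum>k\<le>Suc N. ?c * (real k * ?w k * ?w (Suc N - k) * \<phi> k))
     = (\<Sum>k\<le>N. ?c * (real (Suc k) * ?w (Suc k) * ?w (N - k) * \<phi> (Suc k)))"
    by (subst sum.atMost_Suc_shift) simp
  also have "\<dots> = (\<Sum>k\<le>N. betabin N s k * ((real k + s) / ?D * \<phi> (Suc k)))"
    by (intro sum.cong refl) (simp add: bb_weight_Suc assms betabin_eq del: of_nat_Suc)
  also have "(\<Sum>k\<le>Suc N. ?c * (real (Suc N - k) * ?w (Suc N - k) * ?w k * \<phi> k))
     = (\<Sum>k\<le>N. ?c * (real (Suc (N - k)) * ?w (Suc (N - k)) * ?w k * \<phi> k))"
    by (auto simp: Suc_diff_le simp del: of_nat_Suc of_nat_diff intro!: sum.cong)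
  also have "\<dots> = (\<Sum>k\<le>N. betabin N s k * ((real (N - k) + s) / ?D * \<phi> k))"
    by (intro sum.cong refl) (simp add: bb_weight_Suc assms betabin_eq del: of_nat_Suc)
  finally show ?thesis
    by (simp add: distrib_left sum.distrib)
qed

lemma betabin_sum:
  assumes "0 < s" shows "(\<Sum>k\<le>N. betabin N s k) = 1"
proof (induction N)
  case 0
  then show ?case using Beta_pos[OF assms] by (simp add: betabin_def)
next
  case (Suc N)
  have "(\<Sum>k\<le>Suc N. betabin (Suc N) s k) = (\<Sum>k\<le>N. betabin N s k * 1)"
    using betabin_polya[OF assms, of N "\<lambda>_. 1"]
  proof (simp only: mult_1_right, intro sum.cong refl)
    fix k assume "k \<in> {..N}"
    then have "real (N - k) = real N - real k" by (simp add: of_nat_diff)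
    then have "(real k + s) / (real N + 2 * s) + (real (N - k) + s) / (real N + 2 * s) = 1"
      using assms by (simp add: divide_simps)
    then show "betabin N s k * ((real k + s) / (real N + 2 * s) + (real (N - k) + s) / (real N + 2 * s)) = betabin N s k"
      by (simp only: mult_1_right)
  qed
  then show ?case using Suc by simp
qed

text \<open>The symmetry \<open>k\<close> to \<open>N - k\<close> exchanges the two urn
  probabilities, and they add up to 1. Averaged over the other particles, a tagged particle thus
  goes to a uniform endpoint, which is the source of the walker rate
  \<open>r e / (2 R)\<close>.\<close>

lemma betabin_mean:
  assumes "0 < s"
  shows "(\<Sum>k\<le>N. betabin N s k * ((real k + s) / (real N + 2 * s))) = 1 / 2"
    and "(\<Sum>k\<le>N. betabin N s k * ((real (N - k) + s) / (real N + 2 * s))) = 1 / 2"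
proof -
  let ?p = "\<lambda>k. (real k + s) / (real N + 2 * s)" and ?q = "\<lambda>k. (real (N - k) + s) / (real N + 2 * s)"
  have "(\<Sum>k\<le>N. betabin N s k * ?p k) = (\<Sum>k\<le>N. betabin N s (N - k) * ?p (N - k))"
    by (rule sum.reindex_bij_witness[of _ "\<lambda>k. N - k" "\<lambda>k. N - k"]) auto
  also have "\<dots> = (\<Sum>k\<le>N. betabin N s k * ?q k)"
    by (simp add: betabin_sym assms)
  finally have eq: "(\<Sum>k\<le>N. betabin N s k * ?p k) = (\<Sum>k\<le>N. betabin N s k * ?q k)" .
  have "(\<Sum>k\<le>N. betabin N s k * ?p k) + (\<Sum>k\<le>N. betabin N s k * ?q k) = 1"
    using betabin_polya[OF assms, of N "\<lambda>_. 1"] betabin_sum[OF assms, of "Suc N"]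
    by (simp only: mult_1_right distrib_left sum.distrib)
  with eq show "(\<Sum>k\<le>N. betabin N s k * ?p k) = 1 / 2" "(\<Sum>k\<le>N. betabin N s k * ?q k) = 1 / 2"
    by linarith+
qed

section \<open>Edge updates of configurations\<close>

definition add_particle :: "(nat \<Rightarrow> nat) \<Rightarrow> nat \<Rightarrow> nat \<Rightarrow> nat" where
  "add_particle \<zeta> i = \<zeta>(i := Suc (\<zeta> i))"

definition split_at :: "nat \<Rightarrow> nat \<Rightarrow> (nat \<Rightarrow> nat) \<Rightarrow> nat \<Rightarrow> nat \<Rightarrow> nat" where
  "split_at v w \<zeta> k = \<zeta>(v := k, w := \<zeta> v + \<zeta> w - k)"

definition split_op :: "real \<Rightarrow> nat \<Rightarrow> nat \<Rightarrow> ((nat \<Rightarrow> nat) \<Rightarrow> real) \<Rightarrow> (nat \<Rightarrow> nat) \<Rightarrow> real" where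
  "split_op s v w g \<xi> = (\<Sum>k\<le>\<xi> v + \<xi> w. betabin (\<xi> v + \<xi> w) s k * g (split_at v w \<xi> k))"

lemma split_op_add_outside:
  assumes "i \<noteq> v" "i \<noteq> w"
  shows "split_op s v w g (add_particle \<zeta> i)
    = (\<Sum>k\<le>\<zeta> v + \<zeta> w. betabin (\<zeta> v + \<zeta> w) s k * g (add_particle (split_at v w \<zeta> k) i))"
proof -
  have "split_at v w (add_particle \<zeta> i) k = add_particle (split_at v w \<zeta> k) i" for k
    using assms by (auto simp: split_at_def add_particle_def)
  then show ?thesis using assms by (simp add: split_op_def) (simp add: add_particle_def)
qed

text \<open>By the urn, the added particle chooses its endpoint with a probability determined by the
  split of the others. The right side does not involve \<open>i\<close>, so discrepancies at
  \<open>v\<close> and at \<open>w\<close> coalesce.\<close>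

lemma split_op_add_inside:
  assumes "0 < s" "v \<noteq> w" "i = v \<or> i = w"
  shows "split_op s v w g (add_particle \<zeta> i)
    = (\<Sum>k\<le>\<zeta> v + \<zeta> w. betabin (\<zeta> v + \<zeta> w) s k *
        ((real k + s) / (real (\<zeta> v + \<zeta> w) + 2 * s) * g (add_particle (split_at v w \<zeta> k) v)
       + (real (\<zeta> v + \<zeta> w - k) + s) / (real (\<zeta> v + \<zeta> w) + 2 * s) * g (add_particle (split_at v w \<zeta> k) w)))"
proof -
  let ?N = "\<zeta> v + \<zeta> w" and ?\<xi> = "add_particle \<zeta> i"
  have N: "?\<xi> v + ?\<xi> w = Suc ?N" using assms by (auto simp: add_particle_def)
  have sv: "split_at v w ?\<xi> (Suc k) = add_particle (split_at v w \<zeta> k) v" for k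
    using assms by (auto simp: split_at_def add_particle_def)
  have sw: "split_at v w ?\<xi> k = add_particle (split_at v w \<zeta> k) w" if "k \<le> ?N" for k
    using assms that by (auto simp: split_at_def add_particle_def Suc_diff_le)
  show ?thesis unfolding split_op_def N betabin_polya[OF assms(1)]
    by (intro sum.cong refl) (simp only: sv sw atMost_iff)
qed

text \<open>The expectation of \<open>h\<close> after the edge \<open>e\<close> has rung, when a walker on
  \<open>e\<close> moves to a uniform endpoint and two walkers on \<open>e\<close> coalesce;
  \<open>h\<close> counts as zero after coalescence.\<close>

definition pair_op :: "nat set \<Rightarrow> (nat \<times> nat \<Rightarrow> real) \<Rightarrow> nat \<times> nat \<Rightarrow> real" where
  "pair_op e h = (\<lambda>(i, j). if i \<in> e then if j \<in> e then 0 else (\<Sum>z\<in>e. h (z, j)) / 2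
     else if j \<in> e then (\<Sum>z\<in>e. h (i, z)) / 2 else h (i, j))"

text \<open>Both systems split the common particles in the same way; only the particle at
  \<open>i\<close> then chooses an endpoint. As \<open>hv\<close> and \<open>hw\<close> do not
  depend on the split \<open>k\<close>, only the mean urn probabilities 1/2 survive.\<close>

lemma split_op_contract_one:
  assumes s: "0 < s" and vw: "v \<noteq> w" and i: "i = v \<or> i = w" and j: "j \<noteq> v" "j \<noteq> w"
    and v: "\<And>k. k \<le> \<zeta> v + \<zeta> w \<Longrightarrow>
      \<bar>g (add_particle (split_at v w \<zeta> k) v) - g (add_particle (split_at v w \<zeta> k) j)\<bar> \<le> hv"
    and w: "\<And>k. k \<le> \<zeta> v + \<zeta> w \<Longrightarrow>
      \<bar>g (add_particle (split_at v w \<zeta> k) w) - g (add_particle (split_at v w \<zeta> k) j)\<bar> \<le> hw"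
  shows "\<bar>split_op s v w g (add_particle \<zeta> i) - split_op s v w g (add_particle \<zeta> j)\<bar> \<le> (hv + hw) / 2"
proof -
  let ?N = "\<zeta> v + \<zeta> w"
  let ?p = "\<lambda>k. (real k + s) / (real ?N + 2 * s)" and ?q = "\<lambda>k. (real (?N - k) + s) / (real ?N + 2 * s)"
  let ?g = "\<lambda>k. g (add_particle (split_at v w \<zeta> k) j)"
  let ?gv = "\<lambda>k. g (add_particle (split_at v w \<zeta> k) v)" and ?gw = "\<lambda>k. g (add_particle (split_at v w \<zeta> k) w)"
  let ?b = "betabin ?N s"
  have lin: "(\<Sum>k\<in>A. b k * (p k * x + q k * y)) = (\<Sum>k\<in>A. b k * p k) * x + (\<Sum>k\<in>A. b k * q k) * y"
    for A and b p q :: "nat \<Rightarrow> real" and x y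
    by (simp add: sum_distrib_right sum.distrib distrib_left mult.assoc)
  have pq: "?p k + ?q k = 1" if "k \<le> ?N" for k
    using that s by (simp add: of_nat_diff divide_simps)
  have diff: "split_op s v w g (add_particle \<zeta> i) - split_op s v w g (add_particle \<zeta> j)
     = (\<Sum>k\<le>?N. ?b k * (?p k * (?gv k - ?g k) + ?q k * (?gw k - ?g k)))"
    unfolding split_op_add_inside[OF s vw i] split_op_add_outside[OF j] sum_subtractf[symmetric]
  proof (intro sum.cong refl)
    fix k assume "k \<in> {..?N}"
    then have "?b k * ?g k = ?b k * ((?p k + ?q k) * ?g k)" using pq by simp
    then show "?b k * (?p k * ?gv k + ?q k * ?gw k) - ?b k * ?g k
        = ?b k * (?p k * (?gv k - ?g k) + ?q k * (?gw k - ?g k))"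
      by (simp only: algebra_simps)
  qed
  have "\<bar>split_op s v w g (add_particle \<zeta> i) - split_op s v w g (add_particle \<zeta> j)\<bar>
     \<le> (\<Sum>k\<le>?N. ?b k * (?p k * hv + ?q k * hw))"
    unfolding diff
  proof (rule order_trans[OF sum_abs sum_mono])
    fix k assume k: "k \<in> {..?N}"
    have "\<bar>?p k * (?gv k - ?g k) + ?q k * (?gw k - ?g k)\<bar> \<le> ?p k * \<bar>?gv k - ?g k\<bar> + ?q k * \<bar>?gw k - ?g k\<bar>"
      using s by (intro order_trans[OF abs_triangle_ineq]) (simp add: abs_mult)
    also have "\<dots> \<le> ?p k * hv + ?q k * hw"
      using s v w k by (intro add_mono mult_left_mono) auto
    finally show "\<bar>?b k * (?p k * (?gv k - ?g k) + ?q k * (?gw k - ?g k))\<bar> \<le> ?b k * (?p k * hv + ?q k * hw)"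
      using betabin_nonneg[OF s, of ?N k] by (simp add: abs_mult mult_left_mono)
  qed
  also have "\<dots> = (\<Sum>k\<le>?N. ?b k * ?p k) * hv + (\<Sum>k\<le>?N. ?b k * ?q k) * hw"
    by (rule lin)
  also have "\<dots> = (hv + hw) / 2"
    unfolding betabin_mean[OF s] by simp
  finally show ?thesis .
qed

section \<open>Configuration spaces: closure, removal of a particle, finiteness\<close>

lemma sum_two_point_upd:
  fixes \<xi> \<eta> :: "nat \<Rightarrow> nat"
  assumes "finite A" "v \<in> A" "w \<in> A" "v \<noteq> w" "\<eta> v + \<eta> w = \<xi> v + \<xi> w" "\<And>u. u \<noteq> v \<Longrightarrow> u \<noteq> w \<Longrightarrow> \<eta> u = \<xi> u"
  shows "sum \<eta> A = sum \<xi> A"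
proof -
  have *: "sum f A = f v + (f w + sum f (A - {v} - {w}))" for f :: "nat \<Rightarrow> nat"
    using assms by (simp add: sum.remove[of A v] sum.remove[of "A - {v}" w])
  show ?thesis unfolding * using assms by (auto intro!: sum.cong)
qed

lemma split_at_config:
  assumes "\<zeta> \<in> config_space n m" "v \<in> {1..n}" "w \<in> {1..n}" "v \<noteq> w" "k \<le> \<zeta> v + \<zeta> w"
  shows "split_at v w \<zeta> k \<in> config_space n m"
proof -
  have "sum (split_at v w \<zeta> k) {1..n} = sum \<zeta> {1..n}"
    by (rule sum_two_point_upd[of _ v w]) (use assms in \<open>auto simp: split_at_def\<close>)
  then show ?thesis using assms by (auto simp: config_space_def split_at_def)
qed

lemma add_particle_config:
  assumes "\<zeta> \<in> config_space n m" "i \<in> {1..n}"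
  shows "add_particle \<zeta> i \<in> config_space n (Suc m)"
proof -
  have "sum (add_particle \<zeta> i) {1..n} = Suc (\<zeta> i) + sum (add_particle \<zeta> i) ({1..n} - {i})"
    using assms by (subst sum.remove[of _ i]) (auto simp: add_particle_def)
  also have "sum (add_particle \<zeta> i) ({1..n} - {i}) = sum \<zeta> ({1..n} - {i})"
    by (rule sum.cong) (auto simp: add_particle_def)
  also have "Suc (\<zeta> i) + sum \<zeta> ({1..n} - {i}) = Suc (sum \<zeta> {1..n})"
    using assms(2) by (subst sum.remove[of "{1..n}" i]) auto
  finally show ?thesis using assms by (auto simp: config_space_def add_particle_def)
qed

lemma config_space_SucE:
  assumes "\<xi> \<in> config_space n (Suc m)"
  obtains \<zeta> i where "\<zeta> \<in> config_space n m" "i \<in> {1..n}" "\<xi> = add_particle \<zeta> i"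
proof -
  have "sum \<xi> {1..n} \<noteq> 0" using assms by (simp add: config_space_def)
  then obtain i where i: "i \<in> {1..n}" "\<xi> i \<noteq> 0" by (meson sum.neutral)
  define \<zeta> where "\<zeta> = \<xi>(i := \<xi> i - 1)"
  have \<xi>: "\<xi> = add_particle \<zeta> i" using i by (auto simp: add_particle_def \<zeta>_def)
  have out: "\<zeta> u = 0" if "u \<notin> {1..n}" for u
    using assms that i by (auto simp: \<zeta>_def config_space_def)
  then have "\<zeta> \<in> config_space n (sum \<zeta> {1..n})" by (simp add: config_space_def)
  from add_particle_config[OF this i(1)] have "Suc (sum \<zeta> {1..n}) = Suc m"
    using assms unfolding \<xi>[symmetric] by (simp add: config_space_def)
  with out have "\<zeta> \<in> config_space n m" by (simp add: config_space_def)
  with i \<xi> that show ?thesis by blast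
qed

lemma config_space_0: "config_space n 0 \<subseteq> {\<lambda>_. 0}"
  by (fastforce simp: config_space_def fun_eq_iff)

lemma finite_config_space: "finite (config_space n m)"
proof (induction m)
  case 0
  show ?case using config_space_0 finite_subset by blast
next
  case (Suc m)
  have "config_space n (Suc m) \<subseteq> (\<lambda>(\<zeta>, i). add_particle \<zeta> i) ` (config_space n m \<times> {1..n})"
    by (force elim: config_space_SucE)
  then show ?case using Suc finite_subset by blast
qed

text \<open>The bound \<open>h\<close> depends on the two positions but not on the common particles
  \<open>\<zeta>\<close>. This uniformity lets the pair of positions evolve by
  \<open>pair_op\<close> alone.\<close>

lemma split_op_contract:
  assumes s: "0 < s" and e: "e = {v, w}" "v \<noteq> w" "e \<subseteq> {1..n}"
    and \<zeta>: "\<zeta> \<in> config_space n m" and ij: "i \<in> {1..n}" "j \<in> {1..n}"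
    and g: "\<And>\<zeta> i j. \<zeta> \<in> config_space n m \<Longrightarrow> i \<in> {1..n} \<Longrightarrow> j \<in> {1..n} \<Longrightarrow>
        \<bar>g (add_particle \<zeta> i) - g (add_particle \<zeta> j)\<bar> \<le> h (i, j)"
  shows "\<bar>split_op s v w g (add_particle \<zeta> i) - split_op s v w g (add_particle \<zeta> j)\<bar> \<le> pair_op e h (i, j)"
proof -
  have z: "split_at v w \<zeta> k \<in> config_space n m" if "k \<le> \<zeta> v + \<zeta> w" for k
    using split_at_config[OF \<zeta>] e that by auto
  have V: "v \<in> {1..n}" "w \<in> {1..n}" using e by auto
  consider "i \<in> e" "j \<in> e" | "i \<in> e" "j \<notin> e" | "i \<notin> e" "j \<in> e" | "i \<notin> e" "j \<notin> e" by blast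
  then show ?thesis
  proof cases
    case 1
    then have "split_op s v w g (add_particle \<zeta> i) = split_op s v w g (add_particle \<zeta> j)"
      using split_op_add_inside[OF s e(2)] e(1) by auto
    then show ?thesis using 1 by (simp add: pair_op_def)
  next
    case 2
    have "\<bar>split_op s v w g (add_particle \<zeta> i) - split_op s v w g (add_particle \<zeta> j)\<bar> \<le> (h (v, j) + h (w, j)) / 2"
      by (rule split_op_contract_one) (use 2 s e z g V ij in auto)
    then show ?thesis using 2 e by (simp add: pair_op_def)
  next
    case 3
    have "\<bar>split_op s v w g (add_particle \<zeta> j) - split_op s v w g (add_particle \<zeta> i)\<bar> \<le> (h (i, v) + h (i, w)) / 2"
      by (rule split_op_contract_one) (use 3 s e z g V ij in \<open>auto simp: abs_minus_commute\<close>)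
    then show ?thesis using 3 e by (simp add: pair_op_def abs_minus_commute)
  next
    case 4
    then have ne: "i \<noteq> v" "i \<noteq> w" "j \<noteq> v" "j \<noteq> w" using e by auto
    let ?N = "\<zeta> v + \<zeta> w"
    have "\<bar>split_op s v w g (add_particle \<zeta> i) - split_op s v w g (add_particle \<zeta> j)\<bar>
      \<le> (\<Sum>k\<le>?N. betabin ?N s k * h (i, j))"
      unfolding split_op_add_outside[OF ne(1,2)] split_op_add_outside[OF ne(3,4)] sum_subtractf[symmetric]
      by (rule order_trans[OF sum_abs sum_mono])
         (use z g ij betabin_nonneg[OF s] in \<open>auto simp: abs_mult mult_left_mono simp flip: right_diff_distrib\<close>)
    also have "\<dots> = h (i, j)" by (simp add: betabin_sum[OF s] flip: sum_distrib_right)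
    finally show ?thesis using 4 by (simp add: pair_op_def)
  qed
qed

lemma split_kernel_sum:
  assumes e: "e \<subseteq> {1..n}" "card e = 2" and \<xi>: "\<xi> \<in> config_space n m"
  shows "(\<Sum>\<eta>\<in>config_space n m. split_kernel s e \<xi> \<eta> * g \<eta>) = split_op s (Min e) (Max e) g \<xi>"
proof -
  define v w where "v = Min e" and "w = Max e"
  obtain x y where xy: "e = {x, y}" "x \<noteq> y" using e(2) by (meson card_2_iff)
  then have ne: "v \<noteq> w" and evw: "e = {v, w}" by (auto simp: v_def w_def min_def max_def)
  have V: "v \<in> {1..n}" "w \<in> {1..n}" using e evw by auto
  let ?N = "\<xi> v + \<xi> w"
  let ?T = "split_at v w \<xi> ` {..?N}"
  have inj: "inj_on (split_at v w \<xi>) {..?N}"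
  proof (rule inj_onI)
    fix a b assume "split_at v w \<xi> a = split_at v w \<xi> b"
    then have "split_at v w \<xi> a v = split_at v w \<xi> b v" by simp
    then show "a = b" using ne by (simp add: split_at_def)
  qed
  have T: "?T \<subseteq> config_space n m" using split_at_config[OF \<xi> V ne] by auto
  have zero: "split_kernel s e \<xi> \<eta> = 0" if "\<eta> \<notin> ?T" for \<eta>
  proof (rule ccontr)
    assume "split_kernel s e \<xi> \<eta> \<noteq> 0"
    then have *: "\<forall>u. u \<notin> e \<longrightarrow> \<eta> u = \<xi> u" "\<eta> v + \<eta> w = ?N"
      by (auto simp: split_kernel_def Let_def v_def w_def split: if_splits)
    then have "\<eta> = split_at v w \<xi> (\<eta> v)" using evw by (auto simp: split_at_def fun_eq_iff)
    then have "\<eta> \<in> ?T" using *(2) by (metis atMost_iff imageI le_add1)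
    with that show False by simp
  qed
  have val: "split_kernel s e \<xi> (split_at v w \<xi> k) = betabin ?N s k" if "k \<le> ?N" for k
    unfolding split_kernel_def v_def[symmetric] w_def[symmetric] Let_def
    using that ne evw by (auto simp: split_at_def)
  have "(\<Sum>\<eta>\<in>config_space n m. split_kernel s e \<xi> \<eta> * g \<eta>) = (\<Sum>\<eta>\<in>?T. split_kernel s e \<xi> \<eta> * g \<eta>)"
    by (rule sum.mono_neutral_right) (use T zero finite_config_space in auto)
  also have "\<dots> = (\<Sum>k\<le>?N. betabin ?N s k * g (split_at v w \<xi> k))"
    by (subst sum.reindex[OF inj]) (auto simp: val)
  finally show ?thesis by (simp add: split_op_def v_def w_def)
qed

section \<open>The coupling\<close>

locale bb_graph =
  fixes n :: nat and E :: "nat set set" and r :: "nat set \<Rightarrow> real" and s :: real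
  assumes graph: "weighted_conn_graph n E r" and n_ge_2: "2 \<le> n" and s_pos: "0 < s"
begin

abbreviation "R \<equiv> total_weight E r"

definition bb_kernel :: "(nat \<Rightarrow> nat) \<Rightarrow> (nat \<Rightarrow> nat) \<Rightarrow> real" where
  "bb_kernel \<xi> \<eta> = (\<Sum>e\<in>E. r e / R * split_kernel s e \<xi> \<eta>)"

definition pair_kernel :: "nat \<times> nat \<Rightarrow> nat \<times> nat \<Rightarrow> real" where
  "pair_kernel p q = pair_gen n E r p q + (if p = q then 1 else 0)"

section \<open>Edges and their ringing rates\<close>

lemma edge: "e \<in> E \<Longrightarrow> e \<subseteq> {1..n}" "e \<in> E \<Longrightarrow> card e = 2" "e \<in> E \<Longrightarrow> 0 < r e"
  using graph by (auto simp: weighted_conn_graph_def)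

lemma finite_edges: "finite E"
  using edge(1) by (meson PowI finite_Pow_iff finite_atLeastAtMost finite_subset subsetI)

lemma edge_Min_Max:
  assumes "e \<in> E" shows "Min e \<noteq> Max e" "e = {Min e, Max e}"
proof -
  obtain x y where "e = {x, y}" "x \<noteq> y" using edge(2)[OF assms] by (meson card_2_iff)
  then show "Min e \<noteq> Max e" "e = {Min e, Max e}" by (auto simp: min_def max_def)
qed

lemma edges_nonempty: "E \<noteq> {}"
proof
  assume "E = {}"
  moreover have "(1, 2) \<in> {(x, y). {x, y} \<in> E}\<^sup>*"
    using graph n_ge_2 by (auto simp: weighted_conn_graph_def)
  ultimately show False by (auto elim: rtranclE)
qed

lemma R_pos: "0 < R"
  unfolding total_weight_def using finite_edges edges_nonempty edge(3) by (intro sum_pos) auto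

lemma rate_nonneg: "e \<in> E \<Longrightarrow> 0 \<le> r e / R"
  using edge(3) R_pos by (simp add: less_imp_le)

lemma rates_sum: "(\<Sum>e\<in>E. r e / R) = 1"
  using R_pos by (simp add: total_weight_def flip: sum_divide_distrib)

lemma bb_kernel_sum:
  assumes "\<xi> \<in> config_space n m"
  shows "(\<Sum>\<eta>\<in>config_space n m. bb_kernel \<xi> \<eta> * g \<eta>)
    = (\<Sum>e\<in>E. r e / R * split_op s (Min e) (Max e) g \<xi>)"
proof -
  have "(\<Sum>\<eta>\<in>config_space n m. bb_kernel \<xi> \<eta> * g \<eta>)
    = (\<Sum>e\<in>E. r e / R * (\<Sum>\<eta>\<in>config_space n m. split_kernel s e \<xi> \<eta> * g \<eta>))"
    unfolding bb_kernel_def sum_distrib_left sum_distrib_right mult.assoc by (rule sum.swap)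
  also have "\<dots> = (\<Sum>e\<in>E. r e / R * split_op s (Min e) (Max e) g \<xi>)"
    by (intro sum.cong refl) (simp only: split_kernel_sum[OF edge(1,2) assms])
  finally show ?thesis .
qed

text \<open>Edges ring at total rate 1, so the generator is \<open>bb_kernel\<close> minus the
  identity with no change of time scale.\<close>

lemma bb_uniformized: "uniformized (config_space n m) bb_kernel (BB_gen E r s)"
proof
  show "finite (config_space n m)" by (rule finite_config_space)
  show "0 \<le> bb_kernel \<xi> \<eta>" for \<xi> \<eta>
    unfolding bb_kernel_def
    by (intro sum_nonneg mult_nonneg_nonneg rate_nonneg)
       (auto simp: split_kernel_def Let_def betabin_nonneg s_pos)
  show "(\<Sum>\<eta>\<in>config_space n m. bb_kernel \<xi> \<eta>) \<le> 1" if "\<xi> \<in> config_space n m" for \<xi>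
    using bb_kernel_sum[OF that, of "\<lambda>_. 1"] rates_sum by (simp add: split_op_def betabin_sum s_pos)
  show "BB_gen E r s \<xi> \<eta> = bb_kernel \<xi> \<eta> - (if \<xi> = \<eta> then 1 else 0)" for \<xi> \<eta>
    using rates_sum by (simp add: BB_gen_def bb_kernel_def right_diff_distrib sum_subtractf)
qed

text \<open>Jumping across \<open>e\<close> at rate \<open>r e / (2 R)\<close> is the same as moving
  to a uniform endpoint of \<open>e\<close> at rate \<open>r e / R\<close>. Neighbours of
  \<open>i\<close> are matched with the edges containing \<open>i\<close>.\<close>

lemma walk_gen_sum:
  assumes "i \<in> {1..n}"
  shows "(\<Sum>x\<in>{1..n}. walk_gen n E r i x * \<phi> x)
    = (\<Sum>e\<in>E. if i \<in> e then r e / R * ((\<Sum>z\<in>e. \<phi> z) / 2 - \<phi> i) else 0)"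
proof -
  let ?W = "\<lambda>x. if {i, x} \<in> E then r {i, x} / (2 * R) else 0"
  let ?A = "{x \<in> {1..n} - {i}. {i, x} \<in> E}"
  have inj: "inj_on (\<lambda>x. {i, x}) ?A" by (auto simp: inj_on_def doubleton_eq_iff)
  have img: "(\<lambda>x. {i, x}) ` ?A = {e \<in> E. i \<in> e}"
  proof (intro equalityI subsetI)
    fix e assume e: "e \<in> {e \<in> E. i \<in> e}"
    then obtain x where "e = {i, x}" "x \<noteq> i"
      using edge(2)[of e] by (metis (no_types, lifting) card_2_iff' doubleton_eq_iff insert_absorb2 mem_Collect_eq card_2_iff insertE singletonD)
    then show "e \<in> (\<lambda>x. {i, x}) ` ?A" using e edge(1)[of e] by auto
  qed auto
  have "(\<Sum>x\<in>{1..n}. walk_gen n E r i x * \<phi> x)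
     = walk_gen n E r i i * \<phi> i + (\<Sum>x\<in>{1..n} - {i}. walk_gen n E r i x * \<phi> x)"
    using assms by (subst sum.remove[of _ i]) auto
  also have "(\<Sum>x\<in>{1..n} - {i}. walk_gen n E r i x * \<phi> x) = (\<Sum>x\<in>{1..n} - {i}. ?W x * \<phi> x)"
    by (intro sum.cong refl) (auto simp: walk_gen_def)
  also have "walk_gen n E r i i * \<phi> i = - (\<Sum>x\<in>{1..n} - {i}. ?W x * \<phi> i)"
    by (simp add: walk_gen_def sum_distrib_right)
  also have "- (\<Sum>x\<in>{1..n} - {i}. ?W x * \<phi> i) + (\<Sum>x\<in>{1..n} - {i}. ?W x * \<phi> x)
      = (\<Sum>x\<in>{1..n} - {i}. if {i, x} \<in> E then r {i, x} / (2 * R) * (\<phi> x - \<phi> i) else 0)"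
    unfolding uminus_add_conv_diff sum_subtractf[symmetric]
    by (intro sum.cong refl) (simp add: right_diff_distrib)
  also have "\<dots> = (\<Sum>x\<in>?A. r {i, x} / (2 * R) * (\<phi> x - \<phi> i))"
    by (rule sum.inter_filter[symmetric]) simp
  also have "\<dots> = (\<Sum>x\<in>?A. r {i, x} / R * ((\<Sum>z\<in>{i, x}. \<phi> z) / 2 - \<phi> i))"
    by (intro sum.cong refl) (auto simp: field_simps)
  also have "\<dots> = (\<Sum>e | e \<in> E \<and> i \<in> e. r e / R * ((\<Sum>z\<in>e. \<phi> z) / 2 - \<phi> i))"
    unfolding img[symmetric] by (subst sum.reindex[OF inj]) (simp only: o_def)
  also have "\<dots> = (\<Sum>e\<in>E. if i \<in> e then r e / R * ((\<Sum>z\<in>e. \<phi> z) / 2 - \<phi> i) else 0)"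
    by (rule sum.inter_filter) (rule finite_edges)
  finally show ?thesis .
qed

section \<open>The pair of walkers killed on the diagonal\<close>

lemma finite_off_diag: "finite (off_diag n)"
  by (rule finite_subset[of _ "{1..n} \<times> {1..n}"]) (auto simp: off_diag_def)

text \<open>Independent walkers and walkers driven by common rings differ only on an edge carrying
  both walkers, and there the two descriptions have the same killed generator.\<close>

lemma pair_kernel_sum:
  assumes p: "p \<in> off_diag n" and h: "\<And>x. h (x, x) = 0"
  shows "(\<Sum>q\<in>off_diag n. pair_kernel p q * h q) = (\<Sum>e\<in>E. r e / R * pair_op e h p)"
proof -
  obtain i j where pij: "p = (i, j)" by (cases p)
  have ij: "i \<in> {1..n}" "j \<in> {1..n}" "i \<noteq> j" using p pij by (auto simp: off_diag_def)
  let ?V = "{1..n}"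
  \<comment> \<open>Diagonal states may be added because \<open>h\<close> vanishes there; the sum
    then runs over a product set.\<close>
  have "(\<Sum>q\<in>off_diag n. pair_gen n E r p q * h q) = (\<Sum>q\<in>?V \<times> ?V. pair_gen n E r p q * h q)"
    by (rule sum.mono_neutral_left) (auto simp: off_diag_def h)
  also have "\<dots> = (\<Sum>x\<in>?V. \<Sum>y\<in>?V. pair_gen n E r p (x, y) * h (x, y))"
    by (simp add: sum.cartesian_product)
  also have "\<dots> = (\<Sum>x\<in>?V. \<Sum>y\<in>?V. (if j = y then walk_gen n E r i x * h (x, y) else 0)
        + (if i = x then walk_gen n E r j y * h (x, y) else 0))"
    by (intro sum.cong refl) (simp add: pair_gen_def pij distrib_right)
  also have "\<dots> = (\<Sum>x\<in>?V. \<Sum>y\<in>?V. if j = y then walk_gen n E r i x * h (x, y) else 0)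
      + (\<Sum>y\<in>?V. \<Sum>x\<in>?V. if i = x then walk_gen n E r j y * h (x, y) else 0)"
    unfolding sum.distrib by (subst (3) sum.swap) (rule refl)
  also have "\<dots> = (\<Sum>x\<in>?V. walk_gen n E r i x * h (x, j)) + (\<Sum>y\<in>?V. walk_gen n E r j y * h (i, y))"
    using ij by simp
  also have "\<dots> = (\<Sum>e\<in>E. r e / R * (pair_op e h p - h p))"
    unfolding walk_gen_sum[OF ij(1)] walk_gen_sum[OF ij(2)] sum.distrib[symmetric]
  proof (intro sum.cong refl)
    fix e assume e: "e \<in> E"
    have both: "e = {i, j}" if "i \<in> e" "j \<in> e"
      using that ij(3) edge_Min_Max(2)[OF e] by (metis insert_commute insert_iff singletonD)
    show "(if i \<in> e then r e / R * ((\<Sum>z\<in>e. h (z, j)) / 2 - h (i, j)) else 0)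
       + (if j \<in> e then r e / R * ((\<Sum>z\<in>e. h (i, z)) / 2 - h (i, j)) else 0)
       = r e / R * (pair_op e h p - h p)"
    proof (cases "i \<in> e \<and> j \<in> e")
      \<comment> \<open>Either walker crosses \<open>e\<close> at rate \<open>r e / (2 R)\<close>,
        and either crossing is a meeting. The two contributions add up to
        \<open>- r e / R * h p\<close>, the effect of coalescing at rate
        \<open>r e / R\<close>.\<close>
      case True
      then have "e = {i, j}" using both by blast
      then show ?thesis using ij(3) by (simp add: pair_op_def pij h)
    qed (auto simp: pair_op_def pij)
  qed
  also have "\<dots> = (\<Sum>e\<in>E. r e / R * pair_op e h p) - (\<Sum>e\<in>E. r e / R) * h p"
    by (simp only: right_diff_distrib sum_subtractf sum_distrib_right)
  finally have "(\<Sum>q\<in>off_diag n. pair_gen n E r p q * h q) + h p = (\<Sum>e\<in>E. r e / R * pair_op e h p)"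
    by (simp add: rates_sum)
  moreover have "(\<Sum>q\<in>off_diag n. (if p = q then 1 else 0) * h q) = h p"
    using p by (simp add: finite_off_diag if_distrib[of "\<lambda>a. a * _"] cong: if_cong)
  ultimately show ?thesis by (simp add: pair_kernel_def distrib_right sum.distrib)
qed

text \<open>Entries and row sums are read off \<open>pair_kernel_sum\<close>, with the indicator of
  one state and the indicator of the off-diagonal states as test functions.\<close>

lemma pair_uniformized: "uniformized (off_diag n) pair_kernel (pair_gen n E r)"
proof
  show "finite (off_diag n)" by (rule finite_off_diag)
  show "0 \<le> pair_kernel p q" if "p \<in> off_diag n" "q \<in> off_diag n" for p q
  proof -
    let ?h = "\<lambda>x. if x = q then 1 else (0::real)"
    have "pair_kernel p q = (\<Sum>q'\<in>off_diag n. pair_kernel p q' * ?h q')"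
      using that by (simp add: finite_off_diag if_distrib[of "\<lambda>a. _ * a"] cong: if_cong)
    also have "\<dots> = (\<Sum>e\<in>E. r e / R * pair_op e ?h p)"
      by (rule pair_kernel_sum) (use that in \<open>auto simp: off_diag_def\<close>)
    also have "\<dots> \<ge> 0"
      by (intro sum_nonneg mult_nonneg_nonneg rate_nonneg)
         (auto simp: pair_op_def split: prod.split intro!: sum_nonneg)
    finally show ?thesis .
  qed
  show "(\<Sum>q\<in>off_diag n. pair_kernel p q) \<le> 1" if "p \<in> off_diag n" for p
  proof -
    let ?h = "\<lambda>x. if fst x = snd x then 0 else (1::real)"
    have "(\<Sum>q\<in>off_diag n. pair_kernel p q) = (\<Sum>q\<in>off_diag n. pair_kernel p q * ?h q)"
      by (intro sum.cong refl) (auto simp: off_diag_def)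
    also have "\<dots> = (\<Sum>e\<in>E. r e / R * pair_op e ?h p)"
      by (rule pair_kernel_sum) (use that in auto)
    also have "\<dots> \<le> (\<Sum>e\<in>E. r e / R * 1)"
    proof (intro sum_mono mult_left_mono rate_nonneg)
      fix e assume "e \<in> E"
      have le: "(\<Sum>z\<in>e. f z) \<le> 2" if "\<And>z. f z \<le> 1" for f :: "nat \<Rightarrow> real"
        using sum_bounded_above[of e f 1] that edge(2)[OF \<open>e \<in> E\<close>] by simp
      show "pair_op e ?h p \<le> 1"
        unfolding pair_op_def by (auto split: prod.split intro!: le)
    qed
    finally show ?thesis using rates_sum by simp
  qed
  show "pair_gen n E r p q = pair_kernel p q - (if p = q then 1 else 0)" for p q
    by (simp add: pair_kernel_def)
qed

text \<open>The probability of not having met after \<open>k\<close> steps. The explicit value 0 on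
  the diagonal makes it an admissible \<open>h\<close> for \<open>pair_kernel_sum\<close>.\<close>

definition pair_alive :: "nat \<Rightarrow> nat \<times> nat \<Rightarrow> real" where
  "pair_alive k p = (if fst p = snd p then 0 else \<Sum>q\<in>off_diag n. mpow (off_diag n) pair_kernel k p q)"

lemma pair_alive_Suc:
  assumes "p \<in> off_diag n"
  shows "pair_alive (Suc k) p = (\<Sum>e\<in>E. r e / R * pair_op e (pair_alive k) p)"
proof -
  have "pair_alive (Suc k) p = (\<Sum>q\<in>off_diag n. \<Sum>z\<in>off_diag n. pair_kernel p z * mpow (off_diag n) pair_kernel k z q)"
    using assms by (auto simp: pair_alive_def off_diag_def)
  also have "\<dots> = (\<Sum>z\<in>off_diag n. pair_kernel p z * pair_alive k z)"
    by (subst sum.swap) (auto simp: pair_alive_def sum_distrib_left off_diag_def intro!: sum.cong)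
  also have "\<dots> = (\<Sum>e\<in>E. r e / R * pair_op e (pair_alive k) p)"
    by (rule pair_kernel_sum[OF assms]) (simp add: pair_alive_def)
  finally show ?thesis .
qed

text \<open>Two configurations differing by the position of one particle stay that close,
  and the discrepancy disappears when the two positions meet.\<close>

lemma bb_kernel_contract:
  assumes f: "\<And>\<eta>. \<eta> \<in> config_space n (Suc m) \<Longrightarrow> 0 \<le> f \<eta> \<and> f \<eta> \<le> 1"
    and "\<zeta> \<in> config_space n m" "i \<in> {1..n}" "j \<in> {1..n}"
  defines "S \<equiv> config_space n (Suc m)"
  shows "\<bar>(\<Sum>\<eta>\<in>S. mpow S bb_kernel k (add_particle \<zeta> i) \<eta> * f \<eta>)
        - (\<Sum>\<eta>\<in>S. mpow S bb_kernel k (add_particle \<zeta> j) \<eta> * f \<eta>)\<bar> \<le> pair_alive k (i, j)"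
  using assms(2-4)
proof (induction k arbitrary: \<zeta> i j)
  case 0
  have S: "finite S" "add_particle \<zeta> i \<in> S" "add_particle \<zeta> j \<in> S"
    using add_particle_config 0 by (auto simp: S_def finite_config_space)
  have "(\<Sum>\<eta>\<in>S. mpow S bb_kernel 0 \<xi> \<eta> * f \<eta>) = f \<xi>" if "\<xi> \<in> S" for \<xi>
    using that S(1) by (simp add: if_distrib[of "\<lambda>a. a * _"] cong: if_cong)
  moreover have "pair_alive 0 (i, j) = 1" if "i \<noteq> j"
  proof -
    have "(i, j) \<in> off_diag n" using that 0 by (simp add: off_diag_def)
    then show ?thesis using that by (simp add: pair_alive_def finite_off_diag)
  qed
  moreover have "0 \<le> pair_alive 0 (i, j)" by (auto simp: pair_alive_def sum_nonneg)
  ultimately show ?case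
    using S f[folded S_def] by (cases "i = j") (auto simp del: mpow.simps simp: abs_le_iff, (smt (verit))+)
next
  case (Suc k)
  let ?u = "\<lambda>k \<xi>. \<Sum>\<eta>\<in>S. mpow S bb_kernel k \<xi> \<eta> * f \<eta>"
  \<comment> \<open>Conditioning on the first ring, so that the induction hypothesis applies to the
    remaining \<open>k\<close> steps.\<close>
  have step: "?u (Suc k) \<xi> = (\<Sum>e\<in>E. r e / R * split_op s (Min e) (Max e) (?u k) \<xi>)" if "\<xi> \<in> S" for \<xi>
  proof -
    have "?u (Suc k) \<xi> = (\<Sum>\<zeta>\<in>S. bb_kernel \<xi> \<zeta> * ?u k \<zeta>)"
      by (simp add: sum_distrib_left sum_distrib_right mult.assoc) (rule sum.swap)
    then show ?thesis using bb_kernel_sum that by (simp add: S_def)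
  qed
  show ?case
  proof (cases "i = j")
    case False
    then have p: "(i, j) \<in> off_diag n" using Suc.prems by (auto simp: off_diag_def)
    have "\<bar>?u (Suc k) (add_particle \<zeta> i) - ?u (Suc k) (add_particle \<zeta> j)\<bar>
       \<le> (\<Sum>e\<in>E. r e / R * pair_op e (pair_alive k) (i, j))"
      using Suc.prems
      unfolding step[OF add_particle_config[OF Suc.prems(1,2), folded S_def]]
        step[OF add_particle_config[OF Suc.prems(1,3), folded S_def]] sum_subtractf[symmetric]
    proof (intro order_trans[OF sum_abs sum_mono])
      fix e assume e: "e \<in> E"
      \<comment> \<open>The induction hypothesis, for all \<open>\<zeta>\<close>, \<open>i\<close>
        and \<open>j\<close>, is exactly the assumption of \<open>split_op_contract\<close> with
        \<open>h = pair_alive k\<close>.\<close>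
      have "\<bar>split_op s (Min e) (Max e) (?u k) (add_particle \<zeta> i) - split_op s (Min e) (Max e) (?u k) (add_particle \<zeta> j)\<bar>
         \<le> pair_op e (pair_alive k) (i, j)"
        by (rule split_op_contract[OF s_pos edge_Min_Max(2)[OF e] edge_Min_Max(1)[OF e] edge(1)[OF e] Suc.prems])
           (rule Suc.IH)
      then show "\<bar>r e / R * split_op s (Min e) (Max e) (?u k) (add_particle \<zeta> i)
          - r e / R * split_op s (Min e) (Max e) (?u k) (add_particle \<zeta> j)\<bar> \<le> r e / R * pair_op e (pair_alive k) (i, j)"
        unfolding right_diff_distrib[symmetric] abs_mult
        using rate_nonneg[OF e] by (simp only: abs_of_nonneg mult_left_mono)
    qed
    then show ?thesis unfolding pair_alive_Suc[OF p] .
  qed (simp add: pair_alive_def)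
qed

lemma meet_tail_sums:
  assumes "(i, j) \<in> off_diag n"
  shows "(\<lambda>k. exp (-t) * (t ^ k / fact k) * pair_alive k (i, j)) sums meet_tail n E r i j t"
  using uniformized.expm_sum_sums[OF pair_uniformized assms, of t "\<lambda>_. 1"] assms
  by (simp add: meet_tail_def pair_alive_def off_diag_def)

text \<open>At time \<open>t\<close> both chains take their steps with the same Poisson weights, so
  the discrete bound is averaged term by term.\<close>

lemma expm_contract:
  assumes f: "\<And>\<eta>. \<eta> \<in> config_space n (Suc m) \<Longrightarrow> 0 \<le> f \<eta> \<and> f \<eta> \<le> 1"
    and \<zeta>: "\<zeta> \<in> config_space n m" and ij: "(i, j) \<in> off_diag n" and t: "0 \<le> t"
  defines "S \<equiv> config_space n (Suc m)"
  shows "\<bar>(\<Sum>\<eta>\<in>S. expm S (BB_gen E r s) t (add_particle \<zeta> i) \<eta> * f \<eta>)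
        - (\<Sum>\<eta>\<in>S. expm S (BB_gen E r s) t (add_particle \<zeta> j) \<eta> * f \<eta>)\<bar> \<le> meet_tail n E r i j t"
proof -
  interpret uniformized S bb_kernel "BB_gen E r s" unfolding S_def by (rule bb_uniformized)
  have V: "i \<in> {1..n}" "j \<in> {1..n}" using ij by (auto simp: off_diag_def)
  have mem: "add_particle \<zeta> i \<in> S" "add_particle \<zeta> j \<in> S"
    using add_particle_config[OF \<zeta>] V by (auto simp: S_def)
  let ?D = "\<lambda>k. (\<Sum>\<eta>\<in>S. mpow S bb_kernel k (add_particle \<zeta> i) \<eta> * f \<eta>)
        - (\<Sum>\<eta>\<in>S. mpow S bb_kernel k (add_particle \<zeta> j) \<eta> * f \<eta>)"
  let ?w = "\<lambda>k. exp (-t) * (t ^ k / fact k)"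
  have sums: "(\<lambda>k. ?w k * ?D k) sums
     ((\<Sum>\<eta>\<in>S. expm S (BB_gen E r s) t (add_particle \<zeta> i) \<eta> * f \<eta>)
        - (\<Sum>\<eta>\<in>S. expm S (BB_gen E r s) t (add_particle \<zeta> j) \<eta> * f \<eta>))"
    unfolding right_diff_distrib by (intro sums_diff expm_sum_sums mem)
  have D: "\<bar>?D k\<bar> \<le> pair_alive k (i, j)" for k
    unfolding S_def by (rule bb_kernel_contract[OF f \<zeta> V])
  have w: "0 \<le> ?w k" for k using t by simp
  have up: "?w k * ?D k \<le> ?w k * pair_alive k (i, j)"
    and lo: "- (?w k * pair_alive k (i, j)) \<le> ?w k * ?D k" for k
  proof -
    have "\<bar>?w k * ?D k\<bar> \<le> ?w k * pair_alive k (i, j)"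
      unfolding abs_mult[of "?w k"] abs_of_nonneg[OF w] by (rule mult_left_mono[OF D w])
    then show "?w k * ?D k \<le> ?w k * pair_alive k (i, j)" "- (?w k * pair_alive k (i, j)) \<le> ?w k * ?D k"
      unfolding abs_le_iff by linarith+
  qed
  show ?thesis
    using sums_le[OF up sums meet_tail_sums[OF ij]] sums_le[OF lo sums_minus[OF meet_tail_sums[OF ij]] sums]
    by linarith
qed

end

section \<open>Telescoping over the particles\<close>

lemma add_particle_commute: "add_particle (add_particle \<zeta> i) j = add_particle (add_particle \<zeta> j) i"
  by (auto simp: add_particle_def fun_eq_iff)

text \<open>One configuration is turned into the other by relocating at most \<open>m\<close>
  particles one at a time. Writing \<open>m = Suc k\<close> avoids speaking of
  \<open>m - 1\<close>.\<close>

lemma config_telescope: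
  assumes "\<And>k \<zeta> i j. m = Suc k \<Longrightarrow> \<zeta> \<in> config_space n k \<Longrightarrow> (i, j) \<in> off_diag n \<Longrightarrow>
      \<bar>u (add_particle \<zeta> i) - u (add_particle \<zeta> j)\<bar> \<le> (B::real)"
    and "\<xi> \<in> config_space n m" "\<eta> \<in> config_space n m" "0 \<le> B"
  shows "\<bar>u \<xi> - u \<eta>\<bar> \<le> real m * B"
  using assms(1-3)
proof (induction m arbitrary: u \<xi> \<eta>)
  case 0
  then have "\<xi> = \<eta>" using config_space_0 by blast
  then show ?case by simp
next
  case (Suc m)
  from Suc.prems obtain \<zeta> i where \<xi>: "\<zeta> \<in> config_space n m" "i \<in> {1..n}" "\<xi> = add_particle \<zeta> i"
    by (auto elim: config_space_SucE)
  from Suc.prems obtain \<zeta>' j where \<eta>: "\<zeta>' \<in> config_space n m" "j \<in> {1..n}" "\<eta> = add_particle \<zeta>' j"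
    by (auto elim: config_space_SucE)
  \<comment> \<open>The particle at \<open>i\<close> is kept as a spectator: the induction
    hypothesis is applied to \<open>u\<close> composed with adding it.\<close>
  have "\<bar>u (add_particle \<zeta> i) - u (add_particle \<zeta>' i)\<bar> \<le> real m * B"
  proof (rule Suc.IH[OF _ \<xi>(1) \<eta>(1)])
    fix k \<kappa> a b assume k: "m = Suc k" and \<kappa>: "\<kappa> \<in> config_space n k" and ab: "(a, b) \<in> off_diag n"
    have "add_particle \<kappa> i \<in> config_space n m" using add_particle_config[OF \<kappa> \<xi>(2)] k by simp
    from Suc.prems(1)[OF refl this ab]
    show "\<bar>u (add_particle (add_particle \<kappa> a) i) - u (add_particle (add_particle \<kappa> b) i)\<bar> \<le> B"
      by (simp only: add_particle_commute[of \<kappa> _ i])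
  qed
  moreover have "\<bar>u (add_particle \<zeta>' i) - u (add_particle \<zeta>' j)\<bar> \<le> B"
    using Suc.prems(1)[OF refl \<eta>(1), of i j] \<xi>(2) \<eta>(2) assms(4) by (cases "i = j") (auto simp: off_diag_def)
  ultimately show ?case by (simp add: \<xi> \<eta> algebra_simps)
qed

section \<open>Mixing\<close>

context bb_graph
begin

section \<open>Tails of the meeting time\<close>

lemma meet_tail_pos: "(i, j) \<in> off_diag n \<Longrightarrow> 0 \<le> t \<Longrightarrow> 0 < meet_tail n E r i j t"
  using uniformized.expm_row_ge[OF pair_uniformized, of "(i, j)" t] exp_gt_zero[of "-t"]
  unfolding meet_tail_def by linarith

lemma meet_tail_le_1: "(i, j) \<in> off_diag n \<Longrightarrow> 0 \<le> t \<Longrightarrow> meet_tail n E r i j t \<le> 1"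
  unfolding meet_tail_def by (rule uniformized.expm_row[OF pair_uniformized])

text \<open>The Markov property at time \<open>t\<close>: from wherever the unmet pair is, it
  survives a further time \<open>u\<close> with probability at most \<open>c\<close>.\<close>

lemma meet_tail_add:
  assumes ij: "(i, j) \<in> off_diag n" and "0 \<le> t" "0 \<le> u"
    and c: "\<And>i j. (i, j) \<in> off_diag n \<Longrightarrow> meet_tail n E r i j u \<le> c"
  shows "meet_tail n E r i j (t + u) \<le> meet_tail n E r i j t * c"
proof -
  interpret uniformized "off_diag n" pair_kernel "pair_gen n E r" by (rule pair_uniformized)
  let ?P = "expm (off_diag n) (pair_gen n E r)"
  have "meet_tail n E r i j (t + u) = (\<Sum>q\<in>off_diag n. \<Sum>z\<in>off_diag n. ?P t (i, j) z * ?P u z q)"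
    unfolding meet_tail_def by (intro sum.cong refl expm_add ij)
  also have "\<dots> = (\<Sum>z\<in>off_diag n. ?P t (i, j) z * meet_tail n E r (fst z) (snd z) u)"
    by (subst sum.swap) (simp add: meet_tail_def sum_distrib_left)
  also have "\<dots> \<le> (\<Sum>z\<in>off_diag n. ?P t (i, j) z * c)"
    by (intro sum_mono mult_left_mono) (use c expm_nonneg[OF ij] assms in auto)
  finally show ?thesis by (simp add: meet_tail_def sum_distrib_right)
qed

lemma meet_tail_mult:
  assumes "0 \<le> u" and c: "\<And>i j. (i, j) \<in> off_diag n \<Longrightarrow> meet_tail n E r i j u \<le> c"
  shows "(i, j) \<in> off_diag n \<Longrightarrow> meet_tail n E r i j (real k * u) \<le> c ^ k"
proof (induction k)
  case 0
  then show ?case using meet_tail_le_1[of i j 0] by simp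
next
  case (Suc k)
  have c0: "0 \<le> c" using c[OF Suc.prems] meet_tail_pos[OF Suc.prems, of u] assms(1) by linarith
  have "meet_tail n E r i j (real (Suc k) * u) \<le> meet_tail n E r i j (real k * u) * c"
    using meet_tail_add[OF Suc.prems, of "real k * u" u c] assms by (simp add: algebra_simps)
  also have "\<dots> \<le> c ^ k * c" using Suc c0 by (intro mult_right_mono)
  finally show ?case by (simp add: mult.commute)
qed

text \<open>Markov's inequality from the tail integral: tails decrease, so the integral over
  \<open>{0..t}\<close> alone is at least \<open>t\<close> times the tail at
  \<open>t\<close>.\<close>

lemma meet_tail_Markov:
  assumes ij: "(i, j) \<in> off_diag n" and t: "0 \<le> t"
  shows "ennreal (meet_tail n E r i j t * t) \<le> max_exp_meet n E r"
proof -
  have anti: "meet_tail n E r i j t \<le> meet_tail n E r i j u" if "0 \<le> u" "u \<le> t" for u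
    using meet_tail_add[OF ij that(1), of "t - u" 1] meet_tail_le_1[of _ _ "t - u"] that by simp
  have "ennreal (meet_tail n E r i j t * t) = ennreal (meet_tail n E r i j t) * ennreal t"
    using meet_tail_pos[OF ij t] t by (simp add: ennreal_mult)
  also have "\<dots> = (\<integral>\<^sup>+ u. ennreal (meet_tail n E r i j t) * indicator {0..t} u \<partial>lborel)"
    using t by (simp add: nn_integral_cmult_indicator)
  also have "\<dots> \<le> exp_meet n E r i j"
    unfolding exp_meet_def
    by (intro nn_integral_mono) (auto simp: indicator_def intro!: ennreal_leI anti)
  also have "\<dots> \<le> max_exp_meet n E r"
    unfolding max_exp_meet_def using SUP_upper[OF ij, of "\<lambda>p. exp_meet n E r (fst p) (snd p)"] by simp
  finally show ?thesis .
qed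

text \<open>Stationarity rewrites the integral of \<open>f\<close> as the
  \<open>\<pi>\<close>-average of the time-\<open>t\<close> expectations, each of which is within
  \<open>m * c\<close> of the one started at \<open>x\<close> by telescoping.\<close>

lemma expm_near_stationary:
  assumes f: "\<And>\<eta>. \<eta> \<in> config_space n m \<Longrightarrow> 0 \<le> f \<eta> \<and> f \<eta> \<le> 1"
    and \<pi>: "is_stationary (config_space n m) (BB_gen E r s) \<pi>" and t: "0 \<le> t"
    and c: "\<And>i j. (i, j) \<in> off_diag n \<Longrightarrow> meet_tail n E r i j t \<le> c" and c0: "0 \<le> c"
    and x: "x \<in> config_space n m"
  shows "\<bar>(\<Sum>y\<in>config_space n m. expm (config_space n m) (BB_gen E r s) t x y * f y)
      - (\<Sum>y\<in>config_space n m. \<pi> y * f y)\<bar> \<le> real m * c"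
proof -
  let ?S = "config_space n m"
  interpret uniformized ?S bb_kernel "BB_gen E r s" by (rule bb_uniformized)
  let ?u = "\<lambda>x. \<Sum>y\<in>?S. expm ?S (BB_gen E r s) t x y * f y"
  have u: "\<bar>?u x - ?u z\<bar> \<le> real m * c" if "z \<in> ?S" for z
  proof (rule config_telescope[OF _ x that c0])
    fix k \<zeta> i j assume "m = Suc k" "\<zeta> \<in> config_space n k" "(i, j) \<in> off_diag n"
    then show "\<bar>?u (add_particle \<zeta> i) - ?u (add_particle \<zeta> j)\<bar> \<le> c"
      using expm_contract[of k f \<zeta> i j t] f t c by force
  qed
  have p: "\<And>x. x \<in> ?S \<Longrightarrow> 0 \<le> \<pi> x" "(\<Sum>x\<in>?S. \<pi> x) = 1"
    using \<pi> by (auto simp: is_stationary_def)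
  have "(\<Sum>y\<in>?S. \<pi> y * f y) = (\<Sum>y\<in>?S. (\<Sum>z\<in>?S. \<pi> z * expm ?S (BB_gen E r s) t z y) * f y)"
    using \<pi> by (intro sum.cong refl) (simp add: stationary_expm is_stationary_def)
  also have "\<dots> = (\<Sum>z\<in>?S. \<pi> z * ?u z)"
    by (simp add: sum_distrib_left sum_distrib_right mult.assoc) (rule sum.swap)
  finally have "?u x - (\<Sum>y\<in>?S. \<pi> y * f y) = (\<Sum>z\<in>?S. \<pi> z) * ?u x - (\<Sum>z\<in>?S. \<pi> z * ?u z)"
    by (simp add: p)
  then have eq: "?u x - (\<Sum>y\<in>?S. \<pi> y * f y) = (\<Sum>z\<in>?S. \<pi> z * (?u x - ?u z))"
    by (simp only: sum_distrib_right sum_subtractf right_diff_distrib)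
  have "\<bar>\<Sum>z\<in>?S. \<pi> z * (?u x - ?u z)\<bar> \<le> (\<Sum>z\<in>?S. \<pi> z * (real m * c))"
    using p(1) u by (intro order_trans[OF sum_abs sum_mono]) (simp only: abs_mult abs_of_nonneg mult_left_mono)
  then show ?thesis unfolding eq by (simp add: p flip: sum_distrib_right)
qed

text \<open>By the factorization of \<open>betabin\<close>, both sides are the norm at the common
  total times the weights of both configurations at \<open>v\<close> and \<open>w\<close>, times the
  shared rest.\<close>

lemma split_kernel_reversible:
  assumes e: "e \<in> E"
  defines "W \<equiv> \<lambda>\<xi>. \<Prod>v\<in>{1..n}. bb_weight s (\<xi> v)"
  shows "W \<xi> * split_kernel s e \<xi> \<eta> = W \<eta> * split_kernel s e \<eta> \<xi>"
proof -
  define v w where "v = Min e" and "w = Max e"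
  have evw: "e = {v, w}" "v \<noteq> w" using edge_Min_Max[OF e] by (auto simp: v_def w_def)
  have V: "v \<in> {1..n}" "w \<in> {1..n}" using edge(1)[OF e] evw by auto
  have W: "W \<xi> = bb_weight s (\<xi> v) * (bb_weight s (\<xi> w) * (\<Prod>u\<in>{1..n} - {v} - {w}. bb_weight s (\<xi> u)))" for \<xi>
    unfolding W_def using V evw by (subst prod.remove[of _ v]; (subst prod.remove[of _ w])?) auto
  show ?thesis
  proof (cases "(\<forall>u. u \<notin> e \<longrightarrow> \<eta> u = \<xi> u) \<and> \<eta> v + \<eta> w = \<xi> v + \<xi> w")
    case True
    then have rest: "(\<Prod>u\<in>{1..n} - {v} - {w}. bb_weight s (\<xi> u)) = (\<Prod>u\<in>{1..n} - {v} - {w}. bb_weight s (\<eta> u))"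
      using evw by (intro prod.cong) auto
    let ?N = "\<xi> v + \<xi> w"
    have "?N - \<xi> v = \<xi> w" "?N - \<eta> v = \<eta> w" "\<xi> v \<le> ?N" "\<eta> v \<le> ?N" using True by auto
    then have "split_kernel s e \<xi> \<eta> = bb_norm s ?N * bb_weight s (\<eta> v) * bb_weight s (\<eta> w)"
      and "split_kernel s e \<eta> \<xi> = bb_norm s ?N * bb_weight s (\<xi> v) * bb_weight s (\<xi> w)"
      using True betabin_eq[OF s_pos, of "\<eta> v" ?N] betabin_eq[OF s_pos, of "\<xi> v" ?N]
      unfolding split_kernel_def v_def[symmetric] w_def[symmetric] Let_def by auto
    then show ?thesis unfolding W rest by (simp add: mult_ac)
  next
    case False
    then have "split_kernel s e \<xi> \<eta> = 0" "split_kernel s e \<eta> \<xi> = 0"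
      unfolding split_kernel_def v_def[symmetric] w_def[symmetric] Let_def by auto
    then show ?thesis by simp
  qed
qed

text \<open>The normalized product weight is stationary by detailed balance. With the uniqueness
  shown in \<open>tmix_le\<close>, it gives the definite description \<open>equilibrium\<close> its
  meaning.\<close>

lemma stationary_exists: "\<exists>\<pi>. is_stationary (config_space n m) (BB_gen E r s) \<pi>"
proof -
  let ?S = "config_space n m"
  define W where "W = (\<lambda>\<xi>. \<Prod>v\<in>{1..n}. bb_weight s (\<xi> v))"
  define Z where "Z = (\<Sum>\<xi>\<in>?S. W \<xi>)"
  have W: "0 < W \<xi>" for \<xi> unfolding W_def by (intro prod_pos) (simp add: bb_weight_pos s_pos)
  have "(\<lambda>u. if u = 1 then m else 0) \<in> ?S" using n_ge_2 by (auto simp: config_space_def)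
  then have Z: "0 < Z" unfolding Z_def using W finite_config_space by (intro sum_pos) auto
  have rev: "W \<xi> * bb_kernel \<xi> \<eta> = W \<eta> * bb_kernel \<eta> \<xi>" for \<xi> \<eta>
    unfolding bb_kernel_def sum_distrib_left
  proof (intro sum.cong refl)
    fix e assume "e \<in> E"
    then have "W \<xi> * split_kernel s e \<xi> \<eta> = W \<eta> * split_kernel s e \<eta> \<xi>"
      unfolding W_def by (rule split_kernel_reversible)
    then show "W \<xi> * (r e / R * split_kernel s e \<xi> \<eta>) = W \<eta> * (r e / R * split_kernel s e \<eta> \<xi>)"
      by (metis mult.left_commute)
  qed
  have zero: "(\<Sum>\<xi>\<in>?S. W \<xi> * BB_gen E r s \<xi> \<eta>) = 0" if \<eta>: "\<eta> \<in> ?S" for \<eta>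
  proof -
    have "(\<Sum>\<xi>\<in>?S. W \<xi> * BB_gen E r s \<xi> \<eta>)
        = (\<Sum>\<xi>\<in>?S. W \<eta> * bb_kernel \<eta> \<xi>) - (\<Sum>\<xi>\<in>?S. if \<xi> = \<eta> then W \<xi> else 0)"
      unfolding sum_subtractf[symmetric]
      by (intro sum.cong refl)
         (use uniformized.Q_eq[OF bb_uniformized _ \<eta>] rev in \<open>auto simp: right_diff_distrib\<close>)
    also have "(\<Sum>\<xi>\<in>?S. W \<eta> * bb_kernel \<eta> \<xi>) = W \<eta> * (\<Sum>\<xi>\<in>?S. bb_kernel \<eta> \<xi> * 1)"
      by (simp add: sum_distrib_left)
    also have "(\<Sum>\<xi>\<in>?S. bb_kernel \<eta> \<xi> * 1) = 1"
      unfolding bb_kernel_sum[OF \<eta>] using rates_sum by (simp add: split_op_def betabin_sum s_pos)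
    finally show ?thesis using \<eta> finite_config_space by simp
  qed
  let ?\<pi> = "\<lambda>\<xi>. if \<xi> \<in> ?S then W \<xi> / Z else 0"
  have "(\<Sum>\<xi>\<in>?S. ?\<pi> \<xi> * BB_gen E r s \<xi> \<eta>) = (\<Sum>\<xi>\<in>?S. W \<xi> * BB_gen E r s \<xi> \<eta>) / Z" for \<eta>
    unfolding sum_divide_distrib by (intro sum.cong refl) simp
  moreover have "(\<Sum>\<xi>\<in>?S. ?\<pi> \<xi>) = 1"
    using Z by (simp add: Z_def flip: sum_divide_distrib)
  ultimately have "is_stationary ?S (BB_gen E r s) ?\<pi>"
    using W Z zero by (auto simp: is_stationary_def less_imp_le)
  then show ?thesis by blast
qed

lemma tmix_le:
  assumes t: "0 \<le> t" and c: "\<And>i j. (i, j) \<in> off_diag n \<Longrightarrow> meet_tail n E r i j t \<le> c"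
    and c01: "0 \<le> c" "c < 1" and mc: "real m * c \<le> \<epsilon>"
  shows "tmix_BB n E r s m \<epsilon> \<le> t"
proof -
  let ?S = "config_space n m" and ?Q = "BB_gen E r s"
  \<comment> \<open>Uniqueness comes from the contraction itself: at time \<open>k * t\<close> the
    tails are at most \<open>c ^ k\<close>, which tends to 0 because \<open>c < 1\<close>.\<close>
  have unique: "\<pi> = \<rho>" if \<pi>: "is_stationary ?S ?Q \<pi>" and \<rho>: "is_stationary ?S ?Q \<rho>" for \<pi> \<rho>
  proof
    fix y
    show "\<pi> y = \<rho> y"
    proof (cases "y \<in> ?S")
      case y: True
      let ?f = "\<lambda>x. if x = y then 1 else (0::real)"
      have pick: "(\<Sum>x\<in>?S. \<sigma> x * ?f x) = \<sigma> y" for \<sigma> :: "(nat \<Rightarrow> nat) \<Rightarrow> real"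
        using y finite_config_space by (simp add: if_distrib[of "\<lambda>a. _ * a"] cong: if_cong)
      have bound: "\<bar>\<pi> y - \<rho> y\<bar> \<le> 2 * real m * c ^ k" for k
      proof -
        have tl: "meet_tail n E r i j (real k * t) \<le> c ^ k" if "(i, j) \<in> off_diag n" for i j
          by (rule meet_tail_mult[OF t c that])
        have "\<bar>expm ?S ?Q (real k * t) y y - \<sigma> y\<bar> \<le> real m * c ^ k" if "is_stationary ?S ?Q \<sigma>" for \<sigma>
          using expm_near_stationary[of m ?f, OF _ that, of "real k * t" "c ^ k" y] tl t c01 y
          by (simp add: pick)
        from this[OF \<pi>] this[OF \<rho>] show ?thesis by linarith
      qed
      have "(\<lambda>k. 2 * real m * c ^ k) \<longlonglongrightarrow> 2 * real m * 0"
        using c01 by (intro tendsto_intros LIMSEQ_realpow_zero)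
      then have "\<bar>\<pi> y - \<rho> y\<bar> \<le> 0"
        using bound by (intro LIMSEQ_le_const[of "\<lambda>k. 2 * real m * c ^ k"]) auto
      then show ?thesis by simp
    qed (use \<pi> \<rho> in \<open>simp add: is_stationary_def\<close>)
  qed
  have st: "is_stationary ?S ?Q (equilibrium ?S ?Q)"
    unfolding equilibrium_def using stationary_exists unique by (metis (no_types, lifting) theI)
  have tv: "tv_dist ?S (expm ?S ?Q t x) (equilibrium ?S ?Q) \<le> \<epsilon>" if x: "x \<in> ?S" for x
  proof -
    let ?\<mu> = "expm ?S ?Q t x" and ?\<pi> = "equilibrium ?S ?Q"
    \<comment> \<open>This event attains the total variation distance.\<close>
    let ?f = "\<lambda>y. if ?\<pi> y \<le> ?\<mu> y then 1 else (0::real)"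
    have "tv_dist ?S ?\<mu> ?\<pi> = (\<Sum>y\<in>?S. ?\<mu> y * ?f y) - (\<Sum>y\<in>?S. ?\<pi> y * ?f y)"
      unfolding tv_dist_def sum_subtractf[symmetric] by (intro sum.cong refl) auto
    also have "\<dots> \<le> real m * c"
      by (rule order_trans[OF abs_ge_self expm_near_stationary[OF _ st t c c01(1) x]]) auto
    finally show ?thesis using mc by linarith
  qed
  show ?thesis unfolding tmix_BB_def tmix_def
    by (rule cInf_lower) (use t tv in \<open>auto intro!: bdd_belowI[of _ 0]\<close>)
qed

text \<open>With \<open>M\<close> the largest expected meeting time, Markov's inequality at time
  \<open>exp 1 * M\<close> bounds every tail by \<open>exp (-1)\<close>. Repeating this over
  \<open>k\<close> blocks, with \<open>k\<close> the ceiling of \<open>ln (m / \<epsilon>)\<close>,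
  brings the tail below \<open>\<epsilon> / m\<close>.\<close>

lemma tmix_BB_bound:
  assumes m: "1 \<le> m" and \<epsilon>: "0 < \<epsilon>" "\<epsilon> < 1 / 4" and "2 * exp 1 \<le> C"
  shows "ennreal (tmix_BB n E r s m \<epsilon>) \<le> ennreal (C * ln ((real n + real m) / \<epsilon>)) * max_exp_meet n E r"
proof -
  let ?L = "ln (real m / \<epsilon>)" and ?L' = "ln ((real n + real m) / \<epsilon>)"
  have arg: "4 \<le> real m / \<epsilon>"
  proof -
    have "4 * \<epsilon> \<le> real m" using m \<epsilon> by simp
    then show ?thesis using \<epsilon> by (simp add: le_divide_eq)
  qed
  have L1: "1 \<le> ?L"
    using arg exp_le by (subst ln_ge_iff) linarith+
  have LL': "?L \<le> ?L'"
    using m \<epsilon> by (intro ln_mono) (auto simp: divide_right_mono)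
  have C0: "0 < C" using assms(4) exp_gt_zero[of "1::real"] by linarith
  have CL: "0 < C * ?L'" using C0 L1 LL' by (intro mult_pos_pos) linarith+
  show ?thesis
  proof (cases "max_exp_meet n E r = top")
    \<comment> \<open>In \<open>ennreal\<close>, 0 times \<open>top\<close> is 0, so the prefactor
      must be seen to be nonzero.\<close>
    case True
    moreover have "ennreal (C * ?L') \<noteq> 0" using CL by (simp only: ennreal_eq_0_iff not_le)
    ultimately have "ennreal (C * ?L') * max_exp_meet n E r = top"
      by (simp only: ennreal_mult_top if_False)
    then show ?thesis by simp
  next
    case False
    then obtain M where M: "max_exp_meet n E r = ennreal M" "0 \<le> M"
      by (cases "max_exp_meet n E r") auto
    have Markov: "meet_tail n E r i j t * t \<le> M" if "(i, j) \<in> off_diag n" "0 \<le> t" for i j t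
      using meet_tail_Markov[OF that] M meet_tail_pos[OF that] that(2) by (simp add: ennreal_le_iff)
    have p12: "(1, 2) \<in> off_diag n" using n_ge_2 by (simp add: off_diag_def)
    have "0 < M" using Markov[OF p12, of 1] meet_tail_pos[OF p12, of 1] by simp
    define \<tau> where "\<tau> = exp 1 * M"
    have \<tau>: "0 < \<tau>" using \<open>0 < M\<close> by (simp add: \<tau>_def)
    have tail: "meet_tail n E r i j \<tau> \<le> exp (-1)" if "(i, j) \<in> off_diag n" for i j
    proof -
      have "meet_tail n E r i j \<tau> \<le> M / \<tau>" using Markov[OF that, of \<tau>] \<tau> by (simp add: le_divide_eq)
      also have "\<dots> = exp (-1)" using \<open>0 < M\<close> by (simp add: \<tau>_def exp_minus divide_simps)
      finally show ?thesis .
    qed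
    define k where "k = nat \<lceil>?L\<rceil>"
    have k: "?L \<le> real k" "real k \<le> ?L + 1" using L1 by (auto simp: k_def of_nat_ceiling) 
    have pw: "exp (-1) ^ k = exp (- real k)" by (simp flip: exp_of_nat_mult)
    have "tmix_BB n E r s m \<epsilon> \<le> real k * \<tau>"
    proof (rule tmix_le[where c = "exp (-1) ^ k"])
      show "meet_tail n E r i j (real k * \<tau>) \<le> exp (-1) ^ k" if "(i, j) \<in> off_diag n" for i j
        by (rule meet_tail_mult[OF _ tail that]) (use \<tau> in auto)
      have "0 < k" using k(1) L1 by (cases k) auto
      then show "exp (-1) ^ k < (1::real)" unfolding pw by simp
      have "exp (- real k) \<le> exp (- ?L)" using k by simp
      also have "\<dots> = \<epsilon> / real m" using m \<epsilon> by (simp add: exp_minus)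
      finally show "real m * exp (-1) ^ k \<le> \<epsilon>" using m unfolding pw by (simp add: field_simps)
    qed (use \<tau> in auto)
    \<comment> \<open>Rounding up costs at most 1, and \<open>?L\<close> is at least 1; this is the
      factor 2 in \<open>2 * exp 1\<close>.\<close>
    also have "\<dots> \<le> (2 * ?L') * \<tau>" using k L1 LL' \<tau> by (intro mult_right_mono) linarith+
    also have "\<dots> = (2 * exp 1) * (?L' * M)" by (simp add: \<tau>_def)
    also have "\<dots> \<le> C * (?L' * M)"
      using assms(4) L1 LL' \<open>0 < M\<close> by (intro mult_right_mono mult_nonneg_nonneg) linarith+
    finally have "tmix_BB n E r s m \<epsilon> \<le> (C * ?L') * M" by (simp add: mult.assoc)
    then have "ennreal (tmix_BB n E r s m \<epsilon>) \<le> ennreal ((C * ?L') * M)" by (rule ennreal_leI)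
    also have "\<dots> = ennreal (C * ?L') * ennreal M" using CL M(2) by (simp add: ennreal_mult)
    finally show ?thesis using M by simp
  qed
qed

end

text \<open>With fewer than two vertices \<open>off_diag n\<close> is empty, so
  \<open>max_exp_meet\<close> is a supremum over the empty set, namely 0, and the mixing time itself
  must be 0. There is at most one configuration.\<close>

lemma tmix_BB_trivial:
  assumes g: "weighted_conn_graph n E r" and n: "n < 2" and m: "0 < m" and \<epsilon>: "0 < \<epsilon>"
  shows "tmix_BB n E r s m \<epsilon> \<le> 0"
proof -
  let ?S = "config_space n m" and ?Q = "BB_gen E r s"
  have "E = {}"
  proof (rule ccontr)
    assume "E \<noteq> {}"
    then obtain e where "e \<subseteq> {1..n}" "card e = 2" using g by (auto simp: weighted_conn_graph_def)
    then have "2 \<le> card {1..n}" by (metis card_mono finite_atLeastAtMost)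
    then show False using n by simp
  qed
  then have Q: "?Q = (\<lambda>_ _. 0)" by (simp add: BB_gen_def fun_eq_iff)
  have tv: "tv_dist ?S (expm ?S ?Q 0 x) (equilibrium ?S ?Q) \<le> \<epsilon>" if x: "x \<in> ?S" for x
  proof -
    have "n \<noteq> 0"
    proof
      assume "n = 0"
      then show False using x m by (simp add: config_space_def)
    qed
    then have n1: "n = 1" using n by simp
    have "\<xi> = x" if "\<xi> \<in> ?S" for \<xi>
    proof
      fix u show "\<xi> u = x u" using that x unfolding n1 by (cases "u = 1") (auto simp: config_space_def)
    qed
    then have S: "?S = {x}" using x by blast
    have "is_stationary {x} ?Q \<pi> \<longleftrightarrow> \<pi> = (\<lambda>y. if y = x then 1 else 0)" for \<pi>
    proof
      assume st: "is_stationary {x} ?Q \<pi>"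
      then have "\<pi> x = 1" "\<And>y. y \<noteq> x \<Longrightarrow> \<pi> y = 0" by (auto simp: is_stationary_def)
      then show "\<pi> = (\<lambda>y. if y = x then 1 else 0)" by auto
    qed (simp add: is_stationary_def Q)
    then have "equilibrium ?S ?Q = (\<lambda>y. if y = x then 1 else 0)"
      unfolding equilibrium_def S by (intro the_equality) blast+
    moreover have "expm ?S ?Q 0 x x = 1"
    proof -
      have "(\<lambda>k. 0 ^ k / fact k * mpow ?S ?Q k x x) = (\<lambda>k. if k = 0 then 1 else (0::real))"
        by (auto simp: fun_eq_iff)
      then show ?thesis unfolding expm_def
        using sums_unique[OF sums_single[of 0 "\<lambda>_. 1 :: real"]] by simp
    qed
    ultimately show ?thesis using \<epsilon> unfolding tv_dist_def S by simp
  qed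
  show ?thesis unfolding tmix_BB_def tmix_def
    by (rule cInf_lower) (use tv in \<open>auto intro!: bdd_belowI[of _ 0]\<close>)
qed

theorem BB_mixing_bound_universal:
  assumes "0 < s" "2 * exp 1 \<le> C"
  shows "BB_mixing_bound s C"
  unfolding BB_mixing_bound_def
proof (intro allI impI)
  fix n m :: nat and E :: "nat set set" and r :: "nat set \<Rightarrow> real" and \<epsilon> :: real
  assume g: "weighted_conn_graph n E r" and m: "2 \<le> m" and \<epsilon>: "0 < \<epsilon>" "\<epsilon> < 1 / 4"
  show "ennreal (tmix_BB n E r s m \<epsilon>) \<le> ennreal (C * ln ((real n + real m) / \<epsilon>)) * max_exp_meet n E r"
  proof (cases "2 \<le> n")
    case True
    then interpret bb_graph n E r s using g assms by unfold_locales
    show ?thesis by (rule tmix_BB_bound) (use m \<epsilon> assms in auto)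
  next
    case False
    then show ?thesis using tmix_BB_trivial[OF g, of m \<epsilon> s] m \<epsilon> by (simp add: ennreal_neg)
  qed
qed

section \<open>The explicit constant\<close>

text \<open>The Beta integral is restricted to \<open>{5/12..7/12}\<close>, of length 1/6, where
  both \<open>t\<close> and \<open>1 - t\<close> are at least 5/12. This yields
  \<open>p_star s \<le> 1\<close> for \<open>s < 20\<close>.\<close>

lemma Beta_ge:
  assumes "0 < (s::real)"
  shows "(5/12) powr (2 * s) / 6 \<le> Beta s s"
proof -
  let ?f = "\<lambda>t::real. t powr (s - 1) * (1 - t) powr (s - 1)"
  have I: "(?f has_integral Beta s s) {0..1}" by (rule has_integral_Beta_real) (use assms in auto)
  have c: "((\<lambda>_. (5/12::real) powr (2 * s)) has_integral (5/12) powr (2 * s) / 6) {5/12..7/12::real}"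
    using has_integral_const_real[of "(5/12::real) powr (2 * s)" "5/12" "7/12"] by simp
  have int: "?f integrable_on {5/12..7/12}"
    by (rule integrable_on_subinterval[OF has_integral_integrable[OF I]]) auto
  have "(5/12) powr (2 * s) / 6 \<le> integral {5/12..7/12} ?f"
  proof (rule has_integral_le[OF c integrable_integral[OF int]])
    fix t :: real assume t: "t \<in> {5/12..7/12}"
    \<comment> \<open>Lowering the exponent from \<open>s\<close> to \<open>s - 1\<close> increases
      the power since \<open>x \<le> 1\<close>; this also covers \<open>s < 1\<close>.\<close>
    have x: "(5/12) powr s \<le> x powr (s - 1)" if "5/12 \<le> x" "x \<le> 1" for x :: real
    proof -
      have "(5/12) powr s \<le> x powr s" using that assms by (intro powr_mono2) auto
      also have "\<dots> \<le> x powr (s - 1)" using that by (intro powr_mono') auto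
      finally show ?thesis .
    qed
    have "(5/12::real) powr (2 * s) = (5/12) powr s * (5/12) powr s"
      by (simp flip: powr_add)
    also have "\<dots> \<le> ?f t" using t by (intro mult_mono x) auto
    finally show "(5/12) powr (2 * s) \<le> ?f t" .
  qed
  also have "\<dots> \<le> integral {0..1} ?f"
    by (rule integral_subset_le[OF _ int has_integral_integrable[OF I]]) auto
  also have "\<dots> = Beta s s" using I by (rule integral_unique)
  finally show ?thesis .
qed

lemma p_star_bounds:
  assumes "0 < s" shows "0 < p_star s" "p_star s \<le> 1"
proof -
  show "0 < p_star s" using assms Beta_pos[OF assms] by (auto simp: p_star_def)
  show "p_star s \<le> 1"
    using assms Beta_pos[OF assms] Beta_ge[OF assms] by (auto simp: p_star_def divide_simps)
qed

text \<open>All factors after \<open>C'\<close> are at least 1 except \<open>ln (a + b)\<close>,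
  which is at least \<open>ln 2\<close> and so at least 1/2. Hence \<open>C' = 4 * exp 1\<close>
  yields \<open>2 * exp 1\<close>.\<close>

lemma C_of_ge:
  assumes "0 < a" "0 < b" "0 < s"
  shows "2 * exp 1 \<le> C_of (4 * exp 1) a b s"
proof -
  let ?P = "p_star s powr (-2)"
  have P: "1 \<le> ?P"
    using p_star_bounds[OF assms(3)] powr_mono'[of "-2" 0 "p_star s"] by simp
  have a: "1 \<le> real a" using assms by simp
  have aP: "1 \<le> real a * ?P" using mult_mono[OF a P] by simp
  have l1: "1 \<le> ln (12 * real a * ?P)"
    using aP exp_le by (subst ln_ge_iff) (simp_all add: mult.assoc)
  have "ln 2 \<le> ln (real a + real b)" using assms by (intro ln_mono) auto
  then have l2: "1 / 2 \<le> ln (real a + real b)" using ln2_ge_two_thirds by linarith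
  have "4 * exp 1 * (1 * 1 * (1 / 2)) \<le> 4 * exp 1 * (real a * ?P * ln (12 * real a * ?P) * ln (real a + real b))"
    using aP l1 l2 by (intro mult_left_mono mult_mono) auto
  then show ?thesis by (simp add: C_of_def mult_ac)
qed

theorem theorem1:
  shows "(\<forall>s::real. s \<in> \<rat> \<longrightarrow> s > 0 \<longrightarrow> (\<exists>C>0. BB_mixing_bound s C))
       \<and> (\<exists>C'>0. \<forall>(a::nat) (b::nat) (s::real). a > 0 \<longrightarrow> b > 0 \<longrightarrow> coprime a b \<longrightarrow>
             s = real b / real a \<longrightarrow> BB_mixing_bound s (C_of C' a b s))"
proof (intro conjI allI impI)
  fix s :: real assume "0 < s"
  then show "\<exists>C>0. BB_mixing_bound s C"
    using BB_mixing_bound_universal[of s "2 * exp 1"] by (intro exI[of _ "2 * exp 1"]) simp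
next
  show "\<exists>C'>0. \<forall>(a::nat) (b::nat) (s::real). a > 0 \<longrightarrow> b > 0 \<longrightarrow> coprime a b \<longrightarrow>
             s = real b / real a \<longrightarrow> BB_mixing_bound s (C_of C' a b s)"
    by (rule exI[of _ "4 * exp 1"]) (auto intro!: BB_mixing_bound_universal C_of_ge)
qed

end
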